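(* Let $\mathcal{A}$ be any classification rule, let $1\leq p\leq n-1$ be such that the following quantities are well defined, and put $m=n-p+1$. Then for every $q\geq1$, $$\mathbb{E}\big[|\widehat R_{p,n}-\mathbb{E}[\widehat R_{p,n}]|^q\big]\leq\mathbb{E}\big[|\widehat R_{1,m}-\mathbb{E}[\widehat R_{1,m}]|^q\big].$$ Furthermore, as long as $p>n/2+1$: (i) for $q=2$, $$\mathbb{E}\big[|\widehat R_{p,n}-\mathbb{E}[\widehat R_{p,n}]|^2\big]\leq\frac{\mathbb{E}\big[|\widehat R_{1,m}-\mathbb{E}[\widehat R_{1,m}]|^2\big]}{\lfloor n/m\rfloor};$$ (ii) for every $q>2$ and every numeric constant $\gamma>0$, $$\mathbb{E}\big[|\widehat R_{p,n}-\mathbb{E}[\widehat R_{p,n}]|^q\big]\leq B(q,\gamma)\,\max\left\{2^q\gamma\Big\lfloor\frac nm\Big\rfloor\,\mathbb{E}\left[\left|\frac{\widehat R_{1,m}-\mathbb{E}[\widehat R_{1,m}]}{\lfloor n/m\rfloor}\right|^q\right],\ \left(\sqrt{\frac{2\,\mathrm{Var}(\widehat R_{1,m})}{\lfloor n/m\rfloor}}\right)^q\right\},$$ where $B(q,\gamma)$ denotes the optimal constant in the Rosenthal inequality recalled in the context.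
   Context: Let $\mathcal{X}\subset\mathbb{R}^d$ and let $\mathcal{D}_n=\{Z_1,\ldots,Z_n\}$, $Z_i=(X_i,Y_i)\in\mathcal{X}\times\{0,1\}$, be i.i.d. copies of a pair $(X,Y)$ with arbitrary distribution. A classification rule $\mathcal{A}$ is a (deterministic) map sending each training sample $\mathcal{D}$ (a finite collection of elements of $\mathcal{X}\times\{0,1\}$, the order of the elements being irrelevant) to a measurable classifier $\mathcal{A}^{\mathcal{D}}:\mathcal{X}\to\{0,1\}$. $\mathcal{E}_{n-p}$ is the set of all subsets of $\{1,\ldots,n\}$ with cardinality $n-p$; for $e\in\mathcal{E}_{n-p}$, $\bar e=\{1,\ldots,n\}\setminus e$ and $\mathcal{D}^e=\{Z_i\mid i\in e\}$. The leave-$p$-out (LpO) estimator is $$\widehat R_{p,n}=\binom np^{-1}\sum_{e\in\mathcal{E}_{n-p}}\Big(\frac1p\sum_{i\in\bar e}\mathbf{1}_{\{\mathcal{A}^{\mathcal{D}^e}(X_i)\neq Y_i\}}\Big).$$ $\widehat R_{1,m}$ is the leave-one-out estimator ($p=1$) computed from $\mathcal{D}_m=\{Z_1,\ldots,Z_m\}$, i.e. $\widehat R_{1,m}=\frac1m\sum_{i=1}^m\mathbf{1}_{\{\mathcal{A}^{\mathcal{D}_m\setminus\{Z_i\}}(X_i)\neq Y_i\}}$. Rosenthal inequality: for $q>2$ and $\gamma>0$, $B(q,\gamma)$ is the smallest constant such that, for every $N\ge 1$ and all independent real random variables $\xi_1,\ldots,\xi_N$ with symmetric distributions, $$\mathbb{E}\Big[\Big|\sum_{i=1}^N\xi_i\Big|^q\Big]\leq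 B(q,\gamma)\max\Big\{\gamma\sum_{i=1}^N\mathbb{E}[|\xi_i|^q],\ \Big(\sqrt{\textstyle\sum_{i=1}^N\mathbb{E}[\xi_i^2]}\Big)^q\Big\}.$$ *)

theory Defs
  imports "HOL-Probability.Probability"
begin

text \<open>
  A single observation is a pair (feature vector, label) with features in
  X \<subseteq> R^d and labels in {0,1}; X itself need not be Borel, so it carries the trace
  of the Borel sigma-algebra.
\<close>

definition observations :: "(real ^ 'd) set \<Rightarrow> ((real ^ 'd) \<times> nat) measure" where
  "observations X = restrict_space borel X \<Otimes>\<^sub>M count_space {0, 1}"

text \<open>
  Training samples are finite multisets: the order of the observations is irrelevant,
  but repeated observations are kept.
\<close>

type_synonym 'd rule = "((real ^ 'd) \<times> nat) multiset \<Rightarrow> (real ^ 'd) \<Rightarrow> nat"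

definition classification_rule :: "(real ^ 'd) set \<Rightarrow> 'd rule \<Rightarrow> bool" where
  "classification_rule X A \<longleftrightarrow>
     (\<forall>D. set_mset D \<subseteq> X \<times> {0, 1} \<longrightarrow>
        A D \<in> restrict_space borel X \<rightarrow>\<^sub>M count_space {0, 1})"

definition subsample :: "(nat \<Rightarrow> 'z) \<Rightarrow> nat set \<Rightarrow> 'z multiset" where
  "subsample z e = image_mset z (mset_set e)"

text \<open>The leave-p-out estimator evaluated at the data \<open>z 1, \<dots>, z n\<close>.\<close>

definition lpo :: "'d rule \<Rightarrow> nat \<Rightarrow> nat \<Rightarrow> (nat \<Rightarrow> (real ^ 'd) \<times> nat) \<Rightarrow> real" where
  "lpo A p n z =
     inverse (real (n choose p)) *
     (\<Sum>e | e \<subseteq> {1..n} \<and> card e = n - p.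
        1 / real p *
        (\<Sum>i\<in>{1..n} - e. of_bool (A (subsample z e) (fst (z i)) \<noteq> snd (z i))))"

text \<open>
  Measurability of each single classifier does not make the estimator a random variable.
  The condition below does; it follows from joint measurability of
  (z_1, \<dots>, z_{n-p}, x) \<mapsto> A^{z_1, \<dots>, z_{n-p}}(x), but is weaker.
\<close>

definition lpo_well_defined :: "(real ^ 'd) set \<Rightarrow> 'd rule \<Rightarrow> nat \<Rightarrow> nat \<Rightarrow> bool" where
  "lpo_well_defined X A p n \<longleftrightarrow>
     lpo A p n \<in> borel_measurable (\<Pi>\<^sub>M i\<in>{1..n}. observations X)"

definition iid :: "'w measure \<Rightarrow> 'z measure \<Rightarrow> 'z measure \<Rightarrow> (nat \<Rightarrow> 'w \<Rightarrow> 'z) \<Rightarrow> nat set \<Rightarrow> bool" where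
  "iid M S P Z I \<longleftrightarrow>
     prob_space.indep_vars M (\<lambda>_. S) Z I \<and> (\<forall>i\<in>I. distr M S (Z i) = P)"

text \<open>
  The random variables live on an arbitrary probability space over the fixed carrier type
  \<^typ>\<open>nat \<Rightarrow> real\<close>, since a definition cannot quantify over types. This loses nothing:
  the inequality only depends on the joint law of the finitely many variables, which is
  realised by the coordinate functions on this type. The q-th moments are required to be
  finite because the Bochner integral of a non-integrable function is 0; when some
  q-th moment is infinite the right-hand side of the inequality is infinite.
\<close>

definition rosenthal_inequality :: "real \<Rightarrow> real \<Rightarrow> real \<Rightarrow> bool" where
  "rosenthal_inequality q \<gamma> C \<longleftrightarrow>
     (\<forall>(M :: (nat \<Rightarrow> real) measure) (N :: nat) (\<xi> :: nat \<Rightarrow> (nat \<Rightarrow> real) \<Rightarrow> real).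
        prob_space M \<and> N \<ge> 1 \<and>
        prob_space.indep_vars M (\<lambda>_. borel) \<xi> {1..N} \<and>
        (\<forall>i\<in>{1..N}. distr M borel (\<xi> i) = distr M borel (\<lambda>\<omega>. - \<xi> i \<omega>)) \<and>
        (\<forall>i\<in>{1..N}. integrable M (\<lambda>\<omega>. \<bar>\<xi> i \<omega>\<bar> powr q)) \<longrightarrow>
        prob_space.expectation M (\<lambda>\<omega>. \<bar>\<Sum>i=1..N. \<xi> i \<omega>\<bar> powr q)
          \<le> C * max (\<gamma> * (\<Sum>i=1..N. prob_space.expectation M (\<lambda>\<omega>. \<bar>\<xi> i \<omega>\<bar> powr q)))
                    (sqrt (\<Sum>i=1..N. prob_space.expectation M (\<lambda>\<omega>. (\<xi> i \<omega>)\<^sup>2)) powr q))"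

definition rosenthal_const :: "real \<Rightarrow> real \<Rightarrow> real" where
  "rosenthal_const q \<gamma> = (LEAST C. rosenthal_inequality q \<gamma> C)"

end

theory Submission
  imports Defs "HOL-Combinatorics.Permutations"
begin

text \<open>
  The leave-p-out estimator is a U-statistic of order m = n - p + 1 whose kernel is the
  leave-one-out estimator: the pairs (e, i) with i outside e correspond to the pairs (s, i) with
  s = insert i e and i in s. Jensen's inequality applied to this average gives the first claim.
  Averaging over all permutations of {1..n} instead writes it as a mean of terms W, each of which
  is itself the mean of n div m independent copies of the kernel over disjoint blocks. By Jensen
  again a centred moment of the estimator is at most that of a single W. For q = 2 this is the
  variance of a mean of independent variables; for q > 2 one symmetrises with an independent
  copy and applies Rosenthal's inequality.

  As \<^const>\<open>rosenthal_const\<close> is a least element, which is arbitrary if there is none, Rosenthal's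
  inequality has to be proved with some finite constant.
\<close>

section \<open>Convexity and growth of powers of the absolute value\<close>

text \<open>\<open>rosenthal_inequality\<close> speaks only of probability spaces over
  \<open>nat \<Rightarrow> real\<close>, while \<open>M\<close> has an arbitrary carrier and need
  not have room for an independent copy of the data. Symmetrisation is therefore not carried out on
  \<open>M\<close>. Only the common law \<nu> of the kernel values is kept, and the argument takes
  place on the product of \<open>2 * k\<close> copies of \<nu>, with \<open>k = n div m\<close>,
  whose points are functions \<open>nat \<Rightarrow> real\<close>. Doubling the sample is also what
  produces the factors \<open>2 powr q\<close> and \<open>2\<close> in the bound for q > 2. The
  explicit constant obtained for Rosenthal's inequality serves only to show that admissible
  constants exist. A least one then exists because every instance of the inequality is a closed
  condition on the constant, and a test case forces the constant to be non-negative. The kernel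
  takes values in [0, 1], so moments of every order are finite.\<close>

lemma convex_on_abs_powr:
  assumes "q \<ge> 1"
  shows "convex_on UNIV (\<lambda>x::real. \<bar>x\<bar> powr q)"
proof (rule convex_onI)
  fix t x y :: real
  assume t: "0 < t" "t < 1"
  have *: "((1 - t) * a + t * b) powr q \<le> (1 - t) * a powr q + t * b powr q"
    if "a \<ge> 0" "b \<ge> 0" for a b :: real
  proof -
    \<comment> \<open>An endpoint 0 is treated apart from two positive ones: the convexity
      inequality then reduces to this scaling bound, which holds because q >= 1 and u < 1.\<close>
    have scale: "(u * c) powr q \<le> u * c powr q" if "0 < u" "u < 1" "c \<ge> 0" for u c :: real
    proof -
      have "u powr q \<le> u powr 1"
        using that assms by (intro powr_mono') auto
      then show ?thesis
        using that by (simp add: powr_mult mult_right_mono)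
    qed
    consider "a = 0" | "b = 0" | "a > 0" "b > 0"
      using \<open>a \<ge> 0\<close> \<open>b \<ge> 0\<close> by linarith
    then show ?thesis
    proof cases
      case 3
      then show ?thesis
        using convex_onD[OF powr_convex[OF assms], of t a b] t by simp
    qed (use scale t that assms in auto)
  qed
  have "\<bar>(1 - t) * x + t * y\<bar> \<le> (1 - t) * \<bar>x\<bar> + t * \<bar>y\<bar>"
    using t abs_triangle_ineq[of "(1 - t) * x" "t * y"] by (simp add: abs_mult)
  then have "\<bar>(1 - t) * x + t * y\<bar> powr q \<le> ((1 - t) * \<bar>x\<bar> + t * \<bar>y\<bar>) powr q"
    using assms by (intro powr_mono2) auto
  also have "\<dots> \<le> (1 - t) * \<bar>x\<bar> powr q + t * \<bar>y\<bar> powr q"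
    by (rule *) auto
  finally show "\<bar>(1 - t) *\<^sub>R x + t *\<^sub>R y\<bar> powr q \<le> (1 - t) * \<bar>x\<bar> powr q + t * \<bar>y\<bar> powr q"
    by simp
qed simp

lemma abs_powr_midpoint:
  fixes x y :: real
  assumes "q \<ge> 1"
  shows "\<bar>(x + y) / 2\<bar> powr q \<le> (\<bar>x\<bar> powr q + \<bar>y\<bar> powr q) / 2"
  using convex_onD[OF convex_on_abs_powr[OF assms], of "1/2" x y] by (simp add: field_simps)

text \<open>Midpoint convexity scaled by 2. The right side is kept as a mean: after symmetrisation
  both terms have the same moment, and exactly the factor \<open>2 powr q\<close> of the theorem is
  left.\<close>

lemma abs_powr_add_le:
  fixes x y :: real
  assumes "q \<ge> 1"
  shows "\<bar>x + y\<bar> powr q \<le> 2 powr q * ((\<bar>x\<bar> powr q + \<bar>y\<bar> powr q) / 2)"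
proof -
  have "\<bar>x + y\<bar> powr q = 2 powr q * \<bar>(x + y) / 2\<bar> powr q"
    by (subst powr_mult[symmetric]) auto
  then show ?thesis
    using abs_powr_midpoint[OF assms, of x y] by simp
qed

text \<open>The excess of the hyperbolic cosine over 1 is exactly
  \<open>exp y * (1 - exp (- y))^2 / 2\<close>, and \<open>1 - exp (- y)\<close> lies between 0 and
  \<open>y\<close>.\<close>

lemma exp_add_exp_minus_le:
  fixes y :: real
  assumes "0 \<le> y"
  shows "(exp y + exp (- y)) / 2 \<le> 1 + y\<^sup>2 * exp y / 2"
proof -
  have "(1 - exp (- y))\<^sup>2 \<le> y\<^sup>2"
    using assms exp_ge_add_one_self[of "- y"] by (intro power_mono) auto
  then have "exp y * (1 - exp (- y))\<^sup>2 \<le> exp y * y\<^sup>2"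
    by (intro mult_left_mono) auto
  moreover have "exp y * (1 - exp (- y))\<^sup>2 = exp y + exp (- y) - 2"
    by (simp add: power2_eq_square algebra_simps flip: exp_add)
  ultimately show ?thesis
    by (simp add: algebra_simps)
qed

text \<open>Bounding \<open>1 + v\<close> by \<open>exp v\<close> for v = u and v = -u gives a
  hyperbolic cosine at \<open>q * u\<close>, in which the first-order terms cancel. As u < 1, the
  remaining exponential is at most \<open>exp q\<close>, which explains the constant.\<close>

lemma one_pm_powr_bound:
  fixes u :: real
  assumes "q \<ge> 0" "0 \<le> u" "u < 1"
  shows "((1 + u) powr q + (1 - u) powr q) / 2 \<le> 1 + q\<^sup>2 * exp q / 2 * u\<^sup>2"
proof -
  have *: "(1 + v) powr q \<le> exp (q * v)" if "v > -1" for v :: real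
  proof -
    have "(1 + v) powr q \<le> exp v powr q"
      using that assms exp_ge_add_one_self[of v] by (intro powr_mono2) auto
    then show ?thesis
      by (simp add: powr_def)
  qed
  have "((1 + u) powr q + (1 - u) powr q) / 2 \<le> (exp (q * u) + exp (- (q * u))) / 2"
    using *[of u] *[of "- u"] assms by simp
  also have "\<dots> \<le> 1 + (q * u)\<^sup>2 * exp (q * u) / 2"
    using assms by (intro exp_add_exp_minus_le) auto
  also have "\<dots> \<le> 1 + (q * u)\<^sup>2 * exp q / 2"
    using assms by (auto intro!: mult_left_mono mult_left_le)
  finally show ?thesis
    by (simp add: power_mult_distrib mult_ac)
qed

text \<open>The two summands of \<open>K\<close> serve two regimes. If x is smaller than s in
  absolute value, \<open>\<bar>s\<bar> powr q\<close> is factored out and the quadratic bound is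
  applied to the ratio u. Otherwise both \<open>s + x\<close> and \<open>s - x\<close> are at most
  twice \<open>\<bar>x\<bar>\<close> in absolute value.\<close>

lemma abs_powr_symmetric_increment:
  fixes s x :: real
  assumes "q > 2"
  defines "K \<equiv> 2 powr q + q\<^sup>2 * exp q / 2"
  shows "(\<bar>s + x\<bar> powr q + \<bar>s - x\<bar> powr q) / 2
         \<le> \<bar>s\<bar> powr q + K * (\<bar>s\<bar> powr (q - 2) * x\<^sup>2 + \<bar>x\<bar> powr q)"
proof -
  have K: "q\<^sup>2 * exp q / 2 \<le> K" "2 powr q \<le> K" "0 \<le> K"
    unfolding K_def by auto
  show ?thesis
  proof (cases "\<bar>x\<bar> < \<bar>s\<bar>")
    case True
    define u where "u = \<bar>x\<bar> / \<bar>s\<bar>"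
    have u: "0 \<le> u" "u < 1" "\<bar>x\<bar> = \<bar>s\<bar> * u"
      using True by (auto simp: u_def)
    have "\<bar>s + x\<bar> powr q + \<bar>s - x\<bar> powr q = (\<bar>s\<bar> + \<bar>x\<bar>) powr q + (\<bar>s\<bar> - \<bar>x\<bar>) powr q"
      using True by (cases "s \<ge> 0"; cases "x \<ge> 0") (auto simp: abs_if)
    also have "\<dots> = (\<bar>s\<bar> * (1 + u)) powr q + (\<bar>s\<bar> * (1 - u)) powr q"
      using u by (simp add: algebra_simps)
    also have "\<dots> = \<bar>s\<bar> powr q * ((1 + u) powr q + (1 - u) powr q)"
      using u(1,2) by (simp add: powr_mult distrib_left[of "\<bar>s\<bar> powr q"])
    finally have "(\<bar>s + x\<bar> powr q + \<bar>s - x\<bar> powr q) / 2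
        = \<bar>s\<bar> powr q * (((1 + u) powr q + (1 - u) powr q) / 2)"
      by simp
    also have "\<dots> \<le> \<bar>s\<bar> powr q * (1 + q\<^sup>2 * exp q / 2 * u\<^sup>2)"
      using assms u by (intro mult_left_mono one_pm_powr_bound) auto
    also have "\<dots> = \<bar>s\<bar> powr q + q\<^sup>2 * exp q / 2 * (\<bar>s\<bar> powr (q - 2) * x\<^sup>2)"
    proof -
      have "\<bar>s\<bar> powr q * u\<^sup>2 = \<bar>s\<bar> powr (q - 2) * x\<^sup>2"
        using True by (simp add: u_def powr_diff power_divide)
      then show ?thesis
        by (simp add: algebra_simps)
    qed
    also have "\<dots> \<le> \<bar>s\<bar> powr q + K * (\<bar>s\<bar> powr (q - 2) * x\<^sup>2)"
      using K by (intro add_left_mono mult_right_mono) auto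
    also have "\<dots> \<le> \<bar>s\<bar> powr q + K * (\<bar>s\<bar> powr (q - 2) * x\<^sup>2 + \<bar>x\<bar> powr q)"
      using K by (intro add_left_mono mult_left_mono) auto
    finally show ?thesis .
  next
    case False
    have "\<bar>s + x\<bar> powr q \<le> (2 * \<bar>x\<bar>) powr q" "\<bar>s - x\<bar> powr q \<le> (2 * \<bar>x\<bar>) powr q"
      using False assms by (auto intro!: powr_mono2)
    then have "(\<bar>s + x\<bar> powr q + \<bar>s - x\<bar> powr q) / 2 \<le> 2 powr q * \<bar>x\<bar> powr q"
      by (simp add: powr_mult)
    also have "\<dots> \<le> K * \<bar>x\<bar> powr q"
      using K by (intro mult_right_mono) auto
    also have "\<dots> \<le> K * (\<bar>s\<bar> powr (q - 2) * x\<^sup>2 + \<bar>x\<bar> powr q)"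
      using K by (intro mult_left_mono) auto
    finally show ?thesis
      by (smt (verit) powr_ge_zero)
  qed
qed

text \<open>Young's inequality without optimised constants: depending on whether \<open>w\<close> is
  at most \<epsilon> times the square of \<open>s\<close>, one of the two terms on the right
  dominates by itself. In the second case the square of \<open>s\<close> is below
  \<open>w / \<epsilon>\<close>, and raising this to the power \<open>(q - 2) / 2\<close> yields the
  power of \<epsilon>.\<close>

lemma abs_powr_young:
  fixes s w :: real
  assumes "q > 2" "\<epsilon> > 0" "w \<ge> 0"
  shows "\<bar>s\<bar> powr (q - 2) * w \<le> \<epsilon> * \<bar>s\<bar> powr q + \<epsilon> powr (1 - q / 2) * w powr (q / 2)"
proof (cases "w \<le> \<epsilon> * s\<^sup>2")
  case True
  have "\<bar>s\<bar> powr (q - 2) * w \<le> \<bar>s\<bar> powr (q - 2) * (\<epsilon> * \<bar>s\<bar> powr 2)"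
    using True by (intro mult_left_mono) (auto simp: powr_numeral)
  also have "\<dots> = \<epsilon> * \<bar>s\<bar> powr q"
    by (simp add: powr_add[symmetric] del: powr_numeral)
  finally show ?thesis
    by (smt (verit) mult_nonneg_nonneg powr_ge_zero)
next
  case False
  then have w: "w > 0"
    using assms by (smt (verit) mult_nonneg_nonneg zero_le_power2)
  have "\<bar>s\<bar> powr (q - 2) = (s\<^sup>2) powr ((q - 2) / 2)"
  proof -
    have "s\<^sup>2 = \<bar>s\<bar> powr 2"
      by (simp add: powr_numeral)
    moreover have "2 * ((q - 2) / 2) = q - 2"
      by simp
    ultimately show ?thesis
      by (simp only: powr_powr)
  qed
  also have "\<dots> \<le> (w / \<epsilon>) powr ((q - 2) / 2)"
    using False assms by (intro powr_mono2) (auto simp: field_simps)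
  also have "\<dots> = \<epsilon> powr (1 - q / 2) * w powr (q / 2 - 1)"
  proof -
    have r: "(q - 2) / 2 = q / 2 - 1" "1 - q / 2 = - (q / 2 - 1)"
      by simp_all
    show ?thesis
      unfolding r powr_minus_divide using assms w by (simp add: powr_divide)
  qed
  finally have "\<bar>s\<bar> powr (q - 2) * w \<le> \<epsilon> powr (1 - q / 2) * w powr (q / 2 - 1) * w"
    using w by (intro mult_right_mono) auto
  also have "\<dots> = \<epsilon> powr (1 - q / 2) * w powr (q / 2)"
    using w by (simp add: powr_diff)
  finally show ?thesis
    using assms by (smt (verit) mult_nonneg_nonneg powr_ge_zero)
qed

section \<open>Rosenthal's inequality for symmetric variables\<close>

lemma abs_powr_le_one_plus:
  fixes x :: real
  assumes "0 \<le> r" "r \<le> q"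
  shows "\<bar>x\<bar> powr r \<le> 1 + \<bar>x\<bar> powr q"
proof (cases "\<bar>x\<bar> \<le> 1")
  case True
  then have "\<bar>x\<bar> powr r \<le> 1 powr r"
    using assms by (intro powr_mono2) auto
  then show ?thesis
    by (smt (verit) powr_ge_zero powr_one_eq_one)
next
  case False
  then show ?thesis
    using powr_mono[OF assms(2), of "\<bar>x\<bar>"] by linarith
qed

lemma (in prob_space) integrable_abs_powr_mono:
  fixes X :: "'a \<Rightarrow> real"
  assumes "X \<in> borel_measurable M" "integrable M (\<lambda>\<omega>. \<bar>X \<omega>\<bar> powr q)" "0 \<le> r" "r \<le> q"
  shows "integrable M (\<lambda>\<omega>. \<bar>X \<omega>\<bar> powr r)"
proof (rule Bochner_Integration.integrable_bound)
  show "integrable M (\<lambda>\<omega>. 1 + \<bar>X \<omega>\<bar> powr q)"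
    using assms by simp
  show "AE \<omega> in M. norm (\<bar>X \<omega>\<bar> powr r) \<le> norm (1 + \<bar>X \<omega>\<bar> powr q)"
    using abs_powr_le_one_plus[OF assms(3,4)] by (intro AE_I2) (smt (verit) powr_ge_zero real_norm_def)
qed (use assms in measurable)

lemma (in prob_space) integrable_square_of_abs_powr:
  fixes X :: "'a \<Rightarrow> real"
  assumes "X \<in> borel_measurable M" "integrable M (\<lambda>\<omega>. \<bar>X \<omega>\<bar> powr q)" "2 \<le> q"
  shows "integrable M (\<lambda>\<omega>. (X \<omega>)\<^sup>2)"
  using integrable_abs_powr_mono[of X q 2] assms by (simp add: powr_numeral)

lemma (in prob_space) integrable_abs_add_powr:
  fixes X S :: "'a \<Rightarrow> real"
  assumes [measurable]: "X \<in> borel_measurable M" "S \<in> borel_measurable M"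
    and int: "integrable M (\<lambda>\<omega>. \<bar>X \<omega>\<bar> powr q)" "integrable M (\<lambda>\<omega>. \<bar>S \<omega>\<bar> powr q)" and "q \<ge> 1"
  shows "integrable M (\<lambda>\<omega>. \<bar>S \<omega> + X \<omega>\<bar> powr q)"
proof (rule Bochner_Integration.integrable_bound)
  show "integrable M (\<lambda>\<omega>. 2 powr q * ((\<bar>S \<omega>\<bar> powr q + \<bar>X \<omega>\<bar> powr q) / 2))"
    using int by simp
  show "AE \<omega> in M. norm (\<bar>S \<omega> + X \<omega>\<bar> powr q)
      \<le> norm (2 powr q * ((\<bar>S \<omega>\<bar> powr q + \<bar>X \<omega>\<bar> powr q) / 2))"
    using abs_powr_add_le[OF \<open>q \<ge> 1\<close>] by (intro AE_I2) (smt (verit) powr_ge_zero real_norm_def)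
qed measurable

context prob_space
begin

context
  fixes X S :: "'a \<Rightarrow> real" and q :: real
  assumes ind: "indep_var borel X borel S"
    and sym: "distr M borel X = distr M borel (\<lambda>\<omega>. - X \<omega>)"
    and int: "integrable M (\<lambda>\<omega>. \<bar>X \<omega>\<bar> powr q)" "integrable M (\<lambda>\<omega>. \<bar>S \<omega>\<bar> powr q)"
    and q: "q > 2"
begin

lemma symmetric_sum_measurable: "X \<in> borel_measurable M" "S \<in> borel_measurable M"
  using indep_var_rv1[OF ind] indep_var_rv2[OF ind] by auto

lemma integrable_symmetric_sum:
  "integrable M (\<lambda>\<omega>. \<bar>S \<omega> + X \<omega>\<bar> powr q)" "integrable M (\<lambda>\<omega>. \<bar>S \<omega> - X \<omega>\<bar> powr q)"
  using integrable_abs_add_powr[of X S q] integrable_abs_add_powr[of "\<lambda>\<omega>. - X \<omega>" S q] int q symmetric_sum_measurable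
  by auto

text \<open>Independence upgrades the symmetry of \<open>X\<close> to equality of the joint laws of
  (X, S) and (-X, S). Averaging over the sign is what lets the pointwise two-sign inequalities be
  integrated.\<close>

lemma symmetric_sum_average:
  "expectation (\<lambda>\<omega>. \<bar>S \<omega> + X \<omega>\<bar> powr q) = expectation (\<lambda>\<omega>. (\<bar>S \<omega> + X \<omega>\<bar> powr q + \<bar>S \<omega> - X \<omega>\<bar> powr q) / 2)"
proof -
  note [measurable] = symmetric_sum_measurable
  have ind': "indep_var borel (\<lambda>\<omega>. - X \<omega>) borel S"
    using indep_var_compose[OF ind, of uminus borel "\<lambda>x. x" borel] by (simp add: comp_def)
  define f :: "real \<times> real \<Rightarrow> real" where "f = (\<lambda>(x, s). \<bar>s + x\<bar> powr q)"
  have [measurable]: "f \<in> borel_measurable (borel \<Otimes>\<^sub>M borel)"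
    unfolding f_def by measurable
  have "distr M (borel \<Otimes>\<^sub>M borel) (\<lambda>\<omega>. (X \<omega>, S \<omega>)) = distr M (borel \<Otimes>\<^sub>M borel) (\<lambda>\<omega>. (- X \<omega>, S \<omega>))"
    using ind ind' sym by (simp add: indep_var_distribution_eq)
  then have "integral\<^sup>L (distr M (borel \<Otimes>\<^sub>M borel) (\<lambda>\<omega>. (X \<omega>, S \<omega>))) f
      = integral\<^sup>L (distr M (borel \<Otimes>\<^sub>M borel) (\<lambda>\<omega>. (- X \<omega>, S \<omega>))) f"
    by simp
  then have "expectation (\<lambda>\<omega>. \<bar>S \<omega> + X \<omega>\<bar> powr q) = expectation (\<lambda>\<omega>. \<bar>S \<omega> - X \<omega>\<bar> powr q)"
    by (simp add: integral_distr) (simp add: f_def)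
  then show ?thesis
    using integrable_symmetric_sum by simp
qed

text \<open>Midpoint convexity takes the place of a conditional Jensen inequality. It makes the
  moments of the partial sums increase, so that all of them can be bounded by the last one.\<close>

lemma symmetric_sum_mono:
  "expectation (\<lambda>\<omega>. \<bar>S \<omega>\<bar> powr q) \<le> expectation (\<lambda>\<omega>. \<bar>S \<omega> + X \<omega>\<bar> powr q)"
  unfolding symmetric_sum_average
proof (intro integral_mono)
  show "\<bar>S \<omega>\<bar> powr q \<le> (\<bar>S \<omega> + X \<omega>\<bar> powr q + \<bar>S \<omega> - X \<omega>\<bar> powr q) / 2" for \<omega>
    using abs_powr_midpoint[of q "S \<omega> + X \<omega>" "S \<omega> - X \<omega>"] q by simp
qed (use int integrable_symmetric_sum in auto)

text \<open>The pointwise increment bound is integrated; independence then factorises its mixed term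
  \<open>(X \<omega>)^2 * \<bar>S \<omega>\<bar> powr (q - 2)\<close>.\<close>

lemma symmetric_sum_increment:
  "expectation (\<lambda>\<omega>. \<bar>S \<omega> + X \<omega>\<bar> powr q) \<le> expectation (\<lambda>\<omega>. \<bar>S \<omega>\<bar> powr q)
     + (2 powr q + q\<^sup>2 * exp q / 2) * (expectation (\<lambda>\<omega>. \<bar>S \<omega>\<bar> powr (q - 2)) * expectation (\<lambda>\<omega>. (X \<omega>)\<^sup>2)
     + expectation (\<lambda>\<omega>. \<bar>X \<omega>\<bar> powr q))"
proof -
  note [measurable] = symmetric_sum_measurable
  define K where "K = 2 powr q + q\<^sup>2 * exp q / 2"
  have S2: "integrable M (\<lambda>\<omega>. \<bar>S \<omega>\<bar> powr (q - 2))"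
    by (rule integrable_abs_powr_mono[of _ q]) (use int q in auto)
  have X2: "integrable M (\<lambda>\<omega>. (X \<omega>)\<^sup>2)"
    by (rule integrable_square_of_abs_powr[of _ q]) (use int q in auto)
  have ind2: "indep_var borel (\<lambda>\<omega>. (X \<omega>)\<^sup>2) borel (\<lambda>\<omega>. \<bar>S \<omega>\<bar> powr (q - 2))"
    using indep_var_compose[OF ind, of "\<lambda>x. x\<^sup>2" borel "\<lambda>x. \<bar>x\<bar> powr (q - 2)" borel]
    by (simp add: comp_def)
  note prod = indep_var_lebesgue_integral[OF ind2 X2 S2] indep_var_integrable[OF ind2 X2 S2]
  have "expectation (\<lambda>\<omega>. \<bar>S \<omega> + X \<omega>\<bar> powr q)
      \<le> expectation (\<lambda>\<omega>. \<bar>S \<omega>\<bar> powr q + K * ((X \<omega>)\<^sup>2 * \<bar>S \<omega>\<bar> powr (q - 2) + \<bar>X \<omega>\<bar> powr q))"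
    unfolding symmetric_sum_average
  proof (intro integral_mono)
    show "(\<bar>S \<omega> + X \<omega>\<bar> powr q + \<bar>S \<omega> - X \<omega>\<bar> powr q) / 2
        \<le> \<bar>S \<omega>\<bar> powr q + K * ((X \<omega>)\<^sup>2 * \<bar>S \<omega>\<bar> powr (q - 2) + \<bar>X \<omega>\<bar> powr q)" for \<omega>
      using abs_powr_symmetric_increment[OF q, of "S \<omega>" "X \<omega>"] by (simp add: K_def mult_ac)
  qed (use int integrable_symmetric_sum prod in auto)
  also have "\<dots> = expectation (\<lambda>\<omega>. \<bar>S \<omega>\<bar> powr q) + K * (expectation (\<lambda>\<omega>. \<bar>S \<omega>\<bar> powr (q - 2)) * expectation (\<lambda>\<omega>. (X \<omega>)\<^sup>2)
     + expectation (\<lambda>\<omega>. \<bar>X \<omega>\<bar> powr q))"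
    using int prod by simp
  finally show ?thesis
    by (simp add: K_def)
qed

end

text \<open>
  The constant is obtained by summing the increments of the q-th moments of the partial sums and
  absorbing the term with exponent q - 2 into the left-hand side by Young's inequality.
\<close>

theorem rosenthal_symmetric:
  fixes \<xi> :: "nat \<Rightarrow> 'a \<Rightarrow> real" and q \<gamma> :: real
  assumes q: "q > 2" and \<gamma>: "\<gamma> > 0" and N: "N \<ge> 1"
    and ind: "indep_vars (\<lambda>_. borel) \<xi> {1..N}"
    and sym: "\<And>i. i \<in> {1..N} \<Longrightarrow> distr M borel (\<xi> i) = distr M borel (\<lambda>\<omega>. - \<xi> i \<omega>)"
    and int: "\<And>i. i \<in> {1..N} \<Longrightarrow> integrable M (\<lambda>\<omega>. \<bar>\<xi> i \<omega>\<bar> powr q)"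
  defines "K \<equiv> 2 powr q + q\<^sup>2 * exp q / 2"
  shows "expectation (\<lambda>\<omega>. \<bar>\<Sum>i=1..N. \<xi> i \<omega>\<bar> powr q)
    \<le> 2 * K * ((1 / (2 * K)) powr (1 - q / 2) + 1 / \<gamma>) *
       max (\<gamma> * (\<Sum>i=1..N. expectation (\<lambda>\<omega>. \<bar>\<xi> i \<omega>\<bar> powr q)))
           (sqrt (\<Sum>i=1..N. expectation (\<lambda>\<omega>. (\<xi> i \<omega>)\<^sup>2)) powr q)"
proof -
  define S where "S = (\<lambda>n \<omega>. \<Sum>i=1..n. \<xi> i \<omega>)"
  define T where "T = (\<lambda>n. expectation (\<lambda>\<omega>. \<bar>S n \<omega>\<bar> powr q))"
  define U where "U = (\<lambda>n. expectation (\<lambda>\<omega>. \<bar>S n \<omega>\<bar> powr (q - 2)))"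
  define a where "a = (\<lambda>i. expectation (\<lambda>\<omega>. \<bar>\<xi> i \<omega>\<bar> powr q))"
  define v where "v = (\<lambda>i. expectation (\<lambda>\<omega>. (\<xi> i \<omega>)\<^sup>2))"
  \<comment> \<open>A common bound for the moments of order q - 2, so that summing the increments
    leaves the single product of \<open>D\<close> with the total variance. Indices stop below
    \<open>N\<close> because the step to \<open>S (Suc n)\<close> involves \<open>U n\<close>. The
    maximum is attained at some \<open>j\<close>, and Young's inequality is needed only
    there.\<close>
  define D where "D = Max (U ` {..<N})"
  have K: "K > 0"
    by (simp add: K_def add_pos_nonneg)
  have av: "a i \<ge> 0" "v i \<ge> 0" for i
    by (simp_all add: a_def v_def)
  have \<xi>_meas: "\<xi> i \<in> borel_measurable M" if "i \<in> {1..N}" for i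
    using ind that by (auto simp: indep_vars_def)
  have S_meas: "S n \<in> borel_measurable M" if "n \<le> N" for n
    using that unfolding S_def by (intro borel_measurable_sum \<xi>_meas) auto
  have S_Suc: "S (Suc n) = (\<lambda>\<omega>. S n \<omega> + \<xi> (Suc n) \<omega>)" for n
    by (simp add: S_def fun_eq_iff)
  have ind_S: "indep_var borel (\<xi> (Suc n)) borel (S n)" if "Suc n \<le> N" for n
    unfolding S_def
    by (rule indep_vars_sum) (use that in \<open>auto intro!: indep_vars_subset[OF ind]\<close>)
  have int_S: "integrable M (\<lambda>\<omega>. \<bar>S n \<omega>\<bar> powr q)" if "n \<le> N" for n
    using that
  proof (induction n)
    case 0
    then show ?case by (simp add: S_def)
  next
    case (Suc n)
    then show ?case
      unfolding S_Suc using q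
      by (intro integrable_abs_add_powr \<xi>_meas S_meas int) auto
  qed
  have step: "T n \<le> T (Suc n)" "T (Suc n) \<le> T n + K * (U n * v (Suc n) + a (Suc n))" if "Suc n \<le> N" for n
    unfolding T_def U_def v_def a_def K_def S_Suc using that q
    by (intro symmetric_sum_mono symmetric_sum_increment ind_S sym int int_S; simp)+
  have mono: "T n \<le> T N" if "n \<le> N" for n
    using that by (induction rule: inc_induct) (auto intro: order_trans[OF step(1)])
  have sum_bound: "T n \<le> K * (D * sum v {1..n} + sum a {1..n})" if "n \<le> N" for n
    using that
  proof (induction n)
    case 0
    then show ?case by (simp add: T_def S_def)
  next
    case (Suc n)
    have "U n \<le> D"
      unfolding D_def using Suc by (intro Max_ge) auto
    then have "T (Suc n) \<le> T n + K * (D * v (Suc n) + a (Suc n))"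
      using step(2)[OF Suc.prems] K av
      by (smt (verit) mult_left_mono mult_right_mono)
    then show ?case
      using Suc by (simp add: algebra_simps)
  qed
  define s2 where "s2 = sum v {1..N}"
  have s2: "s2 \<ge> 0"
    unfolding s2_def by (intro sum_nonneg av)
  \<comment> \<open>Young's inequality is used with \<epsilon> = \<open>1 / (2 * K)\<close>: after
    multiplication by \<open>K\<close> the moment term becomes half of \<open>T N\<close> and can be
    moved to the left.\<close>
  define c where "c = (1 / (2 * K)) powr (1 - q / 2)"
  have "D \<in> U ` {..<N}"
    unfolding D_def using N by (intro Max_in) (auto simp: lessThan_empty_iff)
  then obtain j where j: "j < N" "D = U j"
    by auto
  have "D * s2 = expectation (\<lambda>\<omega>. \<bar>S j \<omega>\<bar> powr (q - 2) * s2)"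
    by (simp add: j U_def)
  also have "\<dots> \<le> expectation (\<lambda>\<omega>. 1 / (2 * K) * \<bar>S j \<omega>\<bar> powr q + c * s2 powr (q / 2))"
  proof (rule integral_mono)
    show "integrable M (\<lambda>\<omega>. \<bar>S j \<omega>\<bar> powr (q - 2) * s2)"
      using integrable_abs_powr_mono[OF S_meas int_S, of j "q - 2"] j q by auto
    show "integrable M (\<lambda>\<omega>. 1 / (2 * K) * \<bar>S j \<omega>\<bar> powr q + c * s2 powr (q / 2))"
      using int_S[of j] j by auto
    show "\<bar>S j \<omega>\<bar> powr (q - 2) * s2 \<le> 1 / (2 * K) * \<bar>S j \<omega>\<bar> powr q + c * s2 powr (q / 2)" for \<omega>
      unfolding c_def using q K s2 by (intro abs_powr_young) auto
  qed
  also have "\<dots> = 1 / (2 * K) * T j + c * s2 powr (q / 2)"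
    using int_S[of j] j by (simp add: T_def prob_space)
  also have "\<dots> \<le> 1 / (2 * K) * T N + c * s2 powr (q / 2)"
    using mono[of j] j K by (simp add: divide_right_mono)
  finally have "K * (D * s2) \<le> T N / 2 + K * (c * s2 powr (q / 2))"
    using K by (simp add: field_simps)
  then have "T N \<le> 2 * K * (c * s2 powr (q / 2) + sum a {1..N})"
    using sum_bound[of N] by (simp add: s2_def algebra_simps)
  also have "s2 powr (q / 2) = sqrt s2 powr q"
    using s2 by (simp add: powr_half_sqrt[symmetric] powr_powr)
  \<comment> \<open>A sum of two terms is replaced by a multiple of their maximum;
    \<open>1 / \<gamma>\<close> compensates for the weight \<gamma> that the sum of moments carries
    there.\<close>
  also have "2 * K * (c * sqrt s2 powr q + sum a {1..N})
      \<le> 2 * K * ((c + 1 / \<gamma>) * max (\<gamma> * sum a {1..N}) (sqrt s2 powr q))"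
  proof (intro mult_left_mono)
    have "c * sqrt s2 powr q \<le> c * max (\<gamma> * sum a {1..N}) (sqrt s2 powr q)"
      by (intro mult_left_mono) (auto simp: c_def)
    moreover have "1 / \<gamma> * (\<gamma> * sum a {1..N}) \<le> 1 / \<gamma> * max (\<gamma> * sum a {1..N}) (sqrt s2 powr q)"
      using \<gamma> by (intro mult_left_mono) auto
    ultimately show "c * sqrt s2 powr q + sum a {1..N}
        \<le> (c + 1 / \<gamma>) * max (\<gamma> * sum a {1..N}) (sqrt s2 powr q)"
      using \<gamma> by (simp add: distrib_right)
  qed (use K in auto)
  finally show ?thesis
    by (simp only: T_def S_def s2_def v_def a_def c_def mult.assoc)
qed

end

text \<open>A single fair sign is the test case: the left side is non-negative and the maximum is at
  least 1, its variance term being 1. The result bounds the admissible constants below and later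
  allows an inequality to be multiplied by the constant.\<close>

lemma rosenthal_inequality_nonneg:
  assumes "rosenthal_inequality q \<gamma> C"
  shows "C \<ge> 0"
proof -
  \<comment> \<open>The fair sign is coded by two constant sequences, since the sample space must
    have type \<open>nat \<Rightarrow> real\<close>.\<close>
  define p :: "(nat \<Rightarrow> real) pmf" where "p = pmf_of_set {\<lambda>_. 1, \<lambda>_. -1}"
  define \<xi> :: "nat \<Rightarrow> (nat \<Rightarrow> real) \<Rightarrow> real" where "\<xi> = (\<lambda>_ \<omega>. \<omega> 0)"
  have neq: "(\<lambda>_::nat. 1 :: real) \<noteq> (\<lambda>_. -1)"
    by (auto simp: fun_eq_iff)
  have abs_\<xi>: "\<bar>\<xi> i \<omega>\<bar> = 1" if "\<omega> \<in> set_pmf p" for i \<omega>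
    using that by (auto simp: p_def \<xi>_def)
  have "map_pmf (\<xi> 1) p = pmf_of_set {1, -1}" "map_pmf (\<lambda>\<omega>. - \<xi> 1 \<omega>) p = pmf_of_set {-1, 1}"
    using neq unfolding p_def \<xi>_def by (subst map_pmf_of_set_inj; auto simp: inj_on_def)+
  then have "map_pmf (\<xi> 1) p = map_pmf (\<lambda>\<omega>. - \<xi> 1 \<omega>) p"
    by (simp add: insert_commute)
  then have "distr (measure_pmf (map_pmf (\<xi> 1) p)) borel id = distr (measure_pmf (map_pmf (\<lambda>\<omega>. - \<xi> 1 \<omega>) p)) borel id"
    by simp
  then have sym: "distr (measure_pmf p) borel (\<xi> 1) = distr (measure_pmf p) borel (\<lambda>\<omega>. - \<xi> 1 \<omega>)"
    unfolding map_pmf_rep_eq by (simp add: distr_distr comp_def id_def)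
  have ind: "prob_space.indep_vars (measure_pmf p) (\<lambda>_. borel) \<xi> {1..1}"
    unfolding prob_space.indep_vars_def2[OF measure_pmf.prob_space_axioms]
      prob_space.indep_sets_def[OF measure_pmf.prob_space_axioms]
    by (auto simp: subset_singleton_iff)
  have int: "integrable (measure_pmf p) (\<lambda>\<omega>. \<bar>\<xi> i \<omega>\<bar> powr q)" for i
    by (rule integrable_measure_pmf_finite) (simp add: p_def)
  have sq: "measure_pmf.expectation p (\<lambda>\<omega>. (\<xi> i \<omega>)\<^sup>2) = 1" for i
  proof -
    have "measure_pmf.expectation p (\<lambda>\<omega>. (\<xi> i \<omega>)\<^sup>2) = measure_pmf.expectation p (\<lambda>\<omega>. 1)"
      using abs_\<xi> by (intro integral_cong_AE AE_pmfI) (auto simp: power2_eq_1_iff abs_eq_iff')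
    then show ?thesis
      by simp
  qed
  have "0 \<le> measure_pmf.expectation p (\<lambda>\<omega>. \<bar>\<Sum>i=1..1. \<xi> i \<omega>\<bar> powr q)"
    by simp
  also have "\<dots> \<le> C * max (\<gamma> * (\<Sum>i=1..1. measure_pmf.expectation p (\<lambda>\<omega>. \<bar>\<xi> i \<omega>\<bar> powr q)))
                    (sqrt (\<Sum>i=1..1. measure_pmf.expectation p (\<lambda>\<omega>. (\<xi> i \<omega>)\<^sup>2)) powr q)"
    by (rule assms[unfolded rosenthal_inequality_def, rule_format])
       (use sym ind int in \<open>auto intro: measure_pmf.prob_space_axioms\<close>)
  finally have "0 \<le> C * max (\<gamma> * (\<Sum>i=1..1. measure_pmf.expectation p (\<lambda>\<omega>. \<bar>\<xi> i \<omega>\<bar> powr q))) 1"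
    by (simp add: sq)
  then show ?thesis
    by (auto simp: zero_le_mult_iff)
qed

lemma rosenthal_inequality_exists:
  assumes "q > 2" "\<gamma> > 0"
  shows "\<exists>C. rosenthal_inequality q \<gamma> C"
  unfolding rosenthal_inequality_def
  using prob_space.rosenthal_symmetric[OF _ assms] by blast

text \<open>Each instance has the form \<open>a \<le> C * b\<close> with \<open>b \<ge> 0\<close>, a
  condition preserved when \<open>C\<close> passes to an infimum. The infimum of the non-empty set
  of admissible constants, which is bounded below, is therefore itself admissible and is the least
  element.\<close>

lemma rosenthal_inequality_rosenthal_const:
  assumes "q > 2" "\<gamma> > 0"
  shows "rosenthal_inequality q \<gamma> (rosenthal_const q \<gamma>)"
proof -
  define R where "R = {C. rosenthal_inequality q \<gamma> C}"
  have ne: "R \<noteq> {}"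
    using rosenthal_inequality_exists[OF assms] by (auto simp: R_def)
  have bdd: "bdd_below R"
    by (rule bdd_belowI[of _ 0]) (auto simp: R_def rosenthal_inequality_nonneg)
  have Inf_R: "a \<le> Inf R * b" if "\<And>C. C \<in> R \<Longrightarrow> a \<le> C * b" "b \<ge> 0" for a b :: real
  proof (cases "b = 0")
    case True
    then show ?thesis
      using that ne by auto
  next
    case False
    then have "a / b \<le> Inf R"
      using that ne by (intro cInf_greatest) (auto simp: field_simps)
    then show ?thesis
      using False that by (simp add: field_simps)
  qed
  have "rosenthal_inequality q \<gamma> (Inf R)"
    unfolding rosenthal_inequality_def
    by (intro allI impI Inf_R) (auto simp: R_def rosenthal_inequality_def le_max_iff_disj)
  moreover from this have "rosenthal_const q \<gamma> = Inf R"
    unfolding rosenthal_const_def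
    by (intro Least_equality cInf_lower bdd) (auto simp: R_def)
  ultimately show ?thesis
    by simp
qed

section \<open>Symmetrisation of means of i.i.d. variables\<close>

lemma (in prob_space) joint_distr_iid:
  assumes "indep_vars (\<lambda>_. S) Y I" "I \<noteq> {}" "\<And>i. i \<in> I \<Longrightarrow> distr M S (Y i) = P"
  shows "distr M (PiM I (\<lambda>_. S)) (\<lambda>\<omega>. \<lambda>i\<in>I. Y i \<omega>) = PiM I (\<lambda>_. P)"
proof -
  have "distr M (PiM I (\<lambda>_. S)) (\<lambda>\<omega>. \<lambda>i\<in>I. Y i \<omega>) = PiM I (\<lambda>i. distr M S (Y i))"
    using assms by (subst indep_vars_iff_distr_eq_PiM'[symmetric]) (auto simp: indep_vars_def)
  also have "\<dots> = PiM I (\<lambda>_. P)"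
    by (intro PiM_cong) (auto simp: assms)
  finally show ?thesis .
qed

lemma distr_PiM_component:
  assumes "prob_space P" "i \<in> I"
  shows "distr (PiM I (\<lambda>_. P)) P (\<lambda>\<omega>. \<omega> i) = P"
  by (rule product_prob_space.PiM_component) (use assms in \<open>auto intro!: product_prob_spaceI\<close>)

lemma indep_vars_PiM_coordinates:
  assumes "prob_space P" "I \<noteq> {}"
  shows "prob_space.indep_vars (PiM I (\<lambda>_. P)) (\<lambda>_. P) (\<lambda>i \<omega>. \<omega> i) I"
proof (subst prob_space.indep_vars_iff_distr_eq_PiM')
  have "(\<Pi>\<^sub>M i\<in>I. distr (PiM I (\<lambda>_. P)) P (\<lambda>\<omega>. \<omega> i)) = PiM I (\<lambda>_. P)"
    by (intro PiM_cong) (auto simp: distr_PiM_component assms)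
  moreover have "distr (PiM I (\<lambda>_. P)) (PiM I (\<lambda>_. P)) (\<lambda>\<omega>. \<lambda>i\<in>I. \<omega> i) = distr (PiM I (\<lambda>_. P)) (PiM I (\<lambda>_. P)) (\<lambda>\<omega>. \<omega>)"
    by (intro distr_cong) (auto simp: space_PiM PiE_restrict)
  ultimately show "distr (PiM I (\<lambda>_. P)) (PiM I (\<lambda>_. P)) (\<lambda>\<omega>. \<lambda>i\<in>I. \<omega> i)
      = (\<Pi>\<^sub>M i\<in>I. distr (PiM I (\<lambda>_. P)) P (\<lambda>\<omega>. \<omega> i))"
    by (simp add: distr_id2)
qed (use assms in \<open>auto intro: prob_space_PiM\<close>)

text \<open>For each fixed value x of \<open>S\<close>, Jensen's inequality in \<open>S'\<close>
  alone, which has mean 0, bounds \<open>\<bar>x\<bar> powr q\<close>. Integrating over the law of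
  \<open>S\<close> is Fubini's theorem, the joint law being a product by independence.\<close>

lemma (in prob_space) expectation_abs_powr_le_diff:
  fixes S S' :: "'a \<Rightarrow> real"
  assumes ind: "indep_var borel S borel S'" and q: "q \<ge> 1"
    and int: "integrable M (\<lambda>\<omega>. \<bar>S \<omega>\<bar> powr q)" "integrable M (\<lambda>\<omega>. \<bar>S' \<omega>\<bar> powr q)"
    and mean: "integrable M S'" "expectation S' = 0"
  shows "expectation (\<lambda>\<omega>. \<bar>S \<omega>\<bar> powr q) \<le> expectation (\<lambda>\<omega>. \<bar>S \<omega> - S' \<omega>\<bar> powr q)"
proof -
  have [measurable]: "S \<in> borel_measurable M" "S' \<in> borel_measurable M"
    using indep_var_rv1[OF ind] indep_var_rv2[OF ind] by auto
  define D where "D = distr M borel S"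
  define D' where "D' = distr M borel S'"
  interpret D: prob_space D
    unfolding D_def by (rule prob_space_distr) simp
  interpret D': prob_space D'
    unfolding D'_def by (rule prob_space_distr) simp
  interpret DD': pair_prob_space D D' ..
  have [measurable_cong]: "sets D = sets borel" "sets D' = sets borel"
    by (simp_all add: D_def D'_def)
  have DD': "D \<Otimes>\<^sub>M D' = distr M (borel \<Otimes>\<^sub>M borel) (\<lambda>\<omega>. (S \<omega>, S' \<omega>))"
    using ind by (simp add: D_def D'_def indep_var_distribution_eq)
  define f :: "real \<times> real \<Rightarrow> real" where "f = (\<lambda>(x, y). \<bar>x - y\<bar> powr q)"
  have [measurable]: "f \<in> borel_measurable (borel \<Otimes>\<^sub>M borel)"
    unfolding f_def by measurable
  have "integrable M (\<lambda>\<omega>. \<bar>S \<omega> - S' \<omega>\<bar> powr q)"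
    using integrable_abs_add_powr[of "\<lambda>\<omega>. - S' \<omega>" S q] int q by simp
  then have int_f: "integrable (D \<Otimes>\<^sub>M D') f"
    unfolding DD' by (simp add: integrable_distr_eq) (simp add: f_def)
  have jensen: "\<bar>x\<bar> powr q \<le> (\<integral>y. f (x, y) \<partial>D')" for x
  proof -
    have int': "integrable D' (\<lambda>y. y)" "(\<integral>y. y \<partial>D') = 0"
      using mean by (simp_all add: D'_def integrable_distr_eq integral_distr)
    have "integrable M (\<lambda>\<omega>. \<bar>x - S' \<omega>\<bar> powr q)"
      using integrable_abs_add_powr[of "\<lambda>\<omega>. - S' \<omega>" "\<lambda>_. x" q] int q by simp
    then have "integrable D' (\<lambda>y. \<bar>x - y\<bar> powr q)"
      by (simp add: D'_def integrable_distr_eq)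
    then have "\<bar>D'.expectation (\<lambda>y. x - y)\<bar> powr q \<le> D'.expectation (\<lambda>y. \<bar>x - y\<bar> powr q)"
      using int' q by (intro D'.jensens_inequality[where I = UNIV] convex_on_abs_powr) auto
    then show ?thesis
      using int' by (simp add: f_def D'.prob_space)
  qed
  have "expectation (\<lambda>\<omega>. \<bar>S \<omega>\<bar> powr q) = (\<integral>x. \<bar>x\<bar> powr q \<partial>D)"
    by (simp add: D_def integral_distr)
  also have "\<dots> \<le> (\<integral>x. (\<integral>y. f (x, y) \<partial>D') \<partial>D)"
    using int by (intro integral_mono jensen DD'.integrable_fst' int_f) (simp add: D_def integrable_distr_eq)
  also have "\<dots> = integral\<^sup>L (D \<Otimes>\<^sub>M D') f"
    by (rule DD'.integral_fst'[OF int_f])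
  also have "\<dots> = expectation (\<lambda>\<omega>. \<bar>S \<omega> - S' \<omega>\<bar> powr q)"
    unfolding DD' by (simp add: integral_distr) (simp add: f_def)
  finally show ?thesis .
qed

text \<open>Coordinates 1 to k act as the sample and coordinates k + 1 to 2k as its independent
  copy, on a product space of the carrier type that \<open>rosenthal_inequality\<close> requires.
  Stating the bound for a law \<nu> makes it applicable to variables on any probability
  space.\<close>

lemma iid_mean_rosenthal_coordinates:
  fixes \<nu> :: "real measure" and k :: nat and q \<gamma> :: real
  assumes \<nu>: "prob_space \<nu>" and sets_\<nu>: "sets \<nu> = sets borel"
    and q: "q > 2" and \<gamma>: "\<gamma> > 0" and k: "k \<ge> 1"
    and int: "integrable \<nu> (\<lambda>x. \<bar>x\<bar> powr q)"
  defines "\<mu> \<equiv> \<integral>x. x \<partial>\<nu>"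
  shows "(\<integral>\<omega>. \<bar>\<Sum>j=1..k. (\<omega> j - \<mu>) / k\<bar> powr q \<partial>PiM {1..k} (\<lambda>_. \<nu>))
    \<le> rosenthal_const q \<gamma> * max (2 powr q * \<gamma> * k * (\<integral>x. \<bar>(x - \<mu>) / k\<bar> powr q \<partial>\<nu>))
                               (sqrt (2 * (\<integral>x. (x - \<mu>)\<^sup>2 \<partial>\<nu>) / k) powr q)"
proof -
  define \<Omega> where "\<Omega> = PiM {1..2 * k} (\<lambda>_::nat. \<nu>)"
  interpret \<nu>: prob_space \<nu> by fact
  interpret \<Omega>: prob_space \<Omega>
    unfolding \<Omega>_def by (intro prob_space_PiM \<nu>)
  note [measurable_cong] = sets_\<nu>
  have space_\<nu>: "space \<nu> = UNIV"
    using sets_eq_imp_space_eq[OF sets_\<nu>] by simp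
  have coord: "(\<lambda>\<omega>. \<omega> i) \<in> borel_measurable \<Omega>" if "i \<in> {1..2 * k}" for i
    unfolding \<Omega>_def using that sets_\<nu> measurable_component_singleton[of i "{1..2 * k}" "\<lambda>_. \<nu>"]
    by (simp cong: measurable_cong_sets)
  have distr_coord: "distr \<Omega> borel (\<lambda>\<omega>. \<omega> i) = \<nu>" if "i \<in> {1..2 * k}" for i
  proof -
    have "distr \<Omega> borel (\<lambda>\<omega>. \<omega> i) = distr \<Omega> \<nu> (\<lambda>\<omega>. \<omega> i)"
      by (intro distr_cong) (auto simp: sets_\<nu>)
    then show ?thesis
      unfolding \<Omega>_def using distr_PiM_component[OF \<nu> that] by simp
  qed
  have ind: "\<Omega>.indep_vars (\<lambda>_. borel) (\<lambda>i \<omega>. \<omega> i) {1..2 * k}"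
  proof -
    have "\<Omega>.indep_vars (\<lambda>_. \<nu>) (\<lambda>i \<omega>. \<omega> i) {1..2 * k}"
      unfolding \<Omega>_def using k by (intro indep_vars_PiM_coordinates \<nu>) auto
    then show ?thesis
      by (rule \<Omega>.indep_vars_compose2[where Y = "\<lambda>_ x. x"]) (simp add: sets_\<nu> cong: measurable_cong_sets)
  qed
  have integral_coord: "\<Omega>.expectation (\<lambda>\<omega>. f (\<omega> i)) = (\<integral>x. f x \<partial>\<nu>)"
    and integrable_coord: "integrable \<Omega> (\<lambda>\<omega>. f (\<omega> i)) \<longleftrightarrow> integrable \<nu> f"
    if "i \<in> {1..2 * k}" "f \<in> borel_measurable borel" for i and f :: "real \<Rightarrow> real"
    using that(2) integral_distr[OF coord[OF that(1)], of f] integrable_distr_eq[OF coord[OF that(1)], of f]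
    unfolding distr_coord[OF that(1)] by simp_all
  have id_meas: "(\<lambda>x. x) \<in> borel_measurable \<nu>"
    by measurable
  have int1: "integrable \<nu> (\<lambda>x. x)"
    using \<nu>.integrable_abs_powr_mono[OF id_meas int, of 1] q integrable_abs_iff[OF id_meas] by simp
  have int2: "integrable \<nu> (\<lambda>x. x\<^sup>2)"
    using \<nu>.integrable_square_of_abs_powr[OF id_meas int] q by simp
  have intc2: "integrable \<nu> (\<lambda>x. (x - \<mu>)\<^sup>2)"
    unfolding power2_diff using int1 int2 by simp
  have intc: "integrable \<nu> (\<lambda>x. \<bar>x - \<mu>\<bar> powr q)"
    using \<nu>.integrable_abs_add_powr[OF _ id_meas _ int, of "\<lambda>_. - \<mu>"] q by simp
  have intck: "integrable \<nu> (\<lambda>x. \<bar>(x - \<mu>) / k\<bar> powr q)"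
    using intc by (simp add: powr_divide)
  have intc1: "integrable \<nu> (\<lambda>x. x - \<mu>)"
    using int1 by simp
  have mean0: "(\<integral>x. x - \<mu> \<partial>\<nu>) = 0"
    using int1 by (simp add: \<mu>_def \<nu>.prob_space)

  define S where "S = (\<lambda>\<omega>::nat \<Rightarrow> real. \<Sum>j=1..k. (\<omega> j - \<mu>) / k)"
  define S' where "S' = (\<lambda>\<omega>::nat \<Rightarrow> real. \<Sum>j=1..k. (\<omega> (k + j) - \<mu>) / k)"
  \<comment> \<open>The centring \<mu> cancels in each pair, so \<open>S - S'\<close> is the sum of
    these symmetric variables.\<close>
  define \<xi> where "\<xi> = (\<lambda>j (\<omega>::nat \<Rightarrow> real). (\<omega> j - \<omega> (k + j)) / k)"
  have in_range: "j \<in> {1..2 * k}" "k + j \<in> {1..2 * k}" if "j \<in> {1..k}" for j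
    using that by auto
  have [measurable]: "S \<in> borel_measurable \<Omega>" "S' \<in> borel_measurable \<Omega>"
    unfolding S_def S'_def
    by (intro borel_measurable_sum borel_measurable_divide borel_measurable_diff borel_measurable_const coord in_range; simp)+
  have pair_distr: "distr \<Omega> (borel \<Otimes>\<^sub>M borel) (\<lambda>\<omega>. (\<omega> a, \<omega> b)) = \<nu> \<Otimes>\<^sub>M \<nu>"
    and pair_ind: "\<Omega>.indep_var borel (\<lambda>\<omega>. \<omega> a) borel (\<lambda>\<omega>. \<omega> b)"
    if "a \<in> {1..2 * k}" "b \<in> {1..2 * k}" "a \<noteq> b" for a b
  proof -
    have "\<Omega>.indep_var borel ((\<lambda>f. f a) \<circ> (\<lambda>\<omega>. restrict (\<lambda>i. \<omega> i) {a}))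
        borel ((\<lambda>f. f b) \<circ> (\<lambda>\<omega>. restrict (\<lambda>i. \<omega> i) {b}))"
      using that by (intro \<Omega>.indep_var_compose[OF \<Omega>.indep_var_restrict[OF ind]]) auto
    then show *: "\<Omega>.indep_var borel (\<lambda>\<omega>. \<omega> a) borel (\<lambda>\<omega>. \<omega> b)"
      by (simp add: comp_def)
    show "distr \<Omega> (borel \<Otimes>\<^sub>M borel) (\<lambda>\<omega>. (\<omega> a, \<omega> b)) = \<nu> \<Otimes>\<^sub>M \<nu>"
      using * that by (simp add: \<Omega>.indep_var_distribution_eq distr_coord)
  qed

  have \<xi>_ind: "\<Omega>.indep_vars (\<lambda>_. borel) \<xi> {1..k}"
  proof -
    have "\<Omega>.indep_vars (\<lambda>j. PiM {j, k + j} (\<lambda>_. borel)) (\<lambda>j \<omega>. restrict (\<lambda>i. \<omega> i) {j, k + j}) {1..k}"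
      by (rule \<Omega>.indep_vars_restrict[OF ind]) (auto simp: disjoint_family_on_def)
    from \<Omega>.indep_vars_compose2[OF this, of "\<lambda>j f. (f j - f (k + j)) / k" "\<lambda>_. borel"]
    show ?thesis
      by (simp add: \<xi>_def)
  qed
  have \<xi>_sym: "distr \<Omega> borel (\<xi> j) = distr \<Omega> borel (\<lambda>\<omega>. - \<xi> j \<omega>)" if "j \<in> {1..k}" for j
  proof -
    \<comment> \<open>The law is the same for every ordered pair of distinct coordinates; exchanging
      \<open>j\<close> and \<open>k + j\<close> changes the sign of \<open>\<xi> j\<close>.\<close>
    have "distr \<Omega> borel (\<lambda>\<omega>. (\<omega> a - \<omega> b) / k) = distr (\<nu> \<Otimes>\<^sub>M \<nu>) borel (\<lambda>(x, y). (x - y) / k)"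
      if "a \<in> {1..2 * k}" "b \<in> {1..2 * k}" "a \<noteq> b" for a b
      unfolding pair_distr[OF that, symmetric] using coord[OF that(1)] coord[OF that(2)]
      by (subst distr_distr) (auto simp: comp_def)
    from this[of j "k + j"] this[of "k + j" j] show ?thesis
      using that in_range[OF that] k by (simp add: \<xi>_def minus_divide_left)
  qed
  have \<xi>_moment: "integrable \<Omega> (\<lambda>\<omega>. \<bar>\<xi> j \<omega>\<bar> powr q)"
    "\<Omega>.expectation (\<lambda>\<omega>. \<bar>\<xi> j \<omega>\<bar> powr q) \<le> 2 powr q * (\<integral>x. \<bar>(x - \<mu>) / k\<bar> powr q \<partial>\<nu>)"
    if "j \<in> {1..k}" for j
  proof -
    define a where "a = (\<lambda>\<omega>::nat \<Rightarrow> real. (\<omega> j - \<mu>) / k)"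
    define b where "b = (\<lambda>\<omega>::nat \<Rightarrow> real. - ((\<omega> (k + j) - \<mu>) / k))"
    have \<xi>_eq: "\<xi> j \<omega> = a \<omega> + b \<omega>" for \<omega>
      by (simp add: \<xi>_def a_def b_def diff_divide_distrib)
    have [measurable]: "a \<in> borel_measurable \<Omega>" "b \<in> borel_measurable \<Omega>"
      using coord[OF in_range(1)[OF that]] coord[OF in_range(2)[OF that]] unfolding a_def b_def by simp_all
    have ab: "integrable \<Omega> (\<lambda>\<omega>. \<bar>a \<omega>\<bar> powr q)" "integrable \<Omega> (\<lambda>\<omega>. \<bar>b \<omega>\<bar> powr q)"
      "\<Omega>.expectation (\<lambda>\<omega>. \<bar>a \<omega>\<bar> powr q) = (\<integral>x. \<bar>(x - \<mu>) / k\<bar> powr q \<partial>\<nu>)"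
      "\<Omega>.expectation (\<lambda>\<omega>. \<bar>b \<omega>\<bar> powr q) = (\<integral>x. \<bar>(x - \<mu>) / k\<bar> powr q \<partial>\<nu>)"
      using integrable_coord[OF in_range(1)[OF that], of "\<lambda>x. \<bar>(x - \<mu>) / k\<bar> powr q"]
        integrable_coord[OF in_range(2)[OF that], of "\<lambda>x. \<bar>(x - \<mu>) / k\<bar> powr q"]
        integral_coord[OF in_range(1)[OF that], of "\<lambda>x. \<bar>(x - \<mu>) / k\<bar> powr q"]
        integral_coord[OF in_range(2)[OF that], of "\<lambda>x. \<bar>(x - \<mu>) / k\<bar> powr q"] intck
      by (simp_all only: a_def b_def abs_minus_cancel) measurable
    show int_\<xi>: "integrable \<Omega> (\<lambda>\<omega>. \<bar>\<xi> j \<omega>\<bar> powr q)"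
      unfolding \<xi>_eq using ab q by (intro \<Omega>.integrable_abs_add_powr) auto
    have "\<Omega>.expectation (\<lambda>\<omega>. \<bar>\<xi> j \<omega>\<bar> powr q)
        \<le> \<Omega>.expectation (\<lambda>\<omega>. 2 powr q * ((\<bar>a \<omega>\<bar> powr q + \<bar>b \<omega>\<bar> powr q) / 2))"
    proof (rule integral_mono)
      show "\<bar>\<xi> j \<omega>\<bar> powr q \<le> 2 powr q * ((\<bar>a \<omega>\<bar> powr q + \<bar>b \<omega>\<bar> powr q) / 2)" for \<omega>
        unfolding \<xi>_eq using q by (intro abs_powr_add_le) simp
    qed (use int_\<xi> ab in auto)
    also have "\<dots> = 2 powr q * (\<integral>x. \<bar>(x - \<mu>) / k\<bar> powr q \<partial>\<nu>)"
      using ab by simp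
    finally show "\<Omega>.expectation (\<lambda>\<omega>. \<bar>\<xi> j \<omega>\<bar> powr q) \<le> 2 powr q * (\<integral>x. \<bar>(x - \<mu>) / k\<bar> powr q \<partial>\<nu>)" .
  qed
  have \<xi>_square: "\<Omega>.expectation (\<lambda>\<omega>. (\<xi> j \<omega>)\<^sup>2) = 2 * (\<integral>x. (x - \<mu>)\<^sup>2 \<partial>\<nu>) / (real k)\<^sup>2" if "j \<in> {1..k}" for j
  proof -
    have "j \<noteq> k + j"
      using k by simp
    note jk = in_range[OF that]
    define u where "u = (\<lambda>\<omega>::nat \<Rightarrow> real. \<omega> j - \<mu>)"
    define w where "w = (\<lambda>\<omega>::nat \<Rightarrow> real. \<omega> (k + j) - \<mu>)"
    have ind_uw: "\<Omega>.indep_var borel u borel w"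
      using \<Omega>.indep_var_compose[OF pair_ind[OF jk \<open>j \<noteq> k + j\<close>], of "\<lambda>x. x - \<mu>" borel "\<lambda>x. x - \<mu>" borel]
      by (simp add: comp_def u_def w_def)
    have f: "(\<lambda>x. x - \<mu>) \<in> borel_measurable borel" "(\<lambda>x. (x - \<mu>)\<^sup>2) \<in> borel_measurable borel"
      by simp_all
    have uw: "integrable \<Omega> u" "integrable \<Omega> w" "integrable \<Omega> (\<lambda>\<omega>. (u \<omega>)\<^sup>2)" "integrable \<Omega> (\<lambda>\<omega>. (w \<omega>)\<^sup>2)"
      unfolding u_def w_def using integrable_coord[OF _ f(1)] integrable_coord[OF _ f(2)] jk intc1 intc2
      by blast+
    have E_uw: "\<Omega>.expectation u = 0" "\<Omega>.expectation (\<lambda>\<omega>. (u \<omega>)\<^sup>2) = (\<integral>x. (x - \<mu>)\<^sup>2 \<partial>\<nu>)"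
      "\<Omega>.expectation (\<lambda>\<omega>. (w \<omega>)\<^sup>2) = (\<integral>x. (x - \<mu>)\<^sup>2 \<partial>\<nu>)"
      unfolding u_def w_def
      by (rule integral_coord[OF jk(1) f(1), unfolded mean0] integral_coord[OF jk(1) f(2)] integral_coord[OF jk(2) f(2)])+
    \<comment> \<open>The cross term has expectation 0 because \<open>u\<close> is centred. The
      second moment thus gets the factor 2, where the general bound for q-th powers would give 4 at
      q = 2.\<close>
    note cross = \<Omega>.indep_var_lebesgue_integral[OF ind_uw uw(1,2)] \<Omega>.indep_var_integrable[OF ind_uw uw(1,2)]
    have "\<Omega>.expectation (\<lambda>\<omega>. (\<xi> j \<omega>)\<^sup>2)
        = \<Omega>.expectation (\<lambda>\<omega>. ((u \<omega>)\<^sup>2 + (w \<omega>)\<^sup>2 - 2 * (u \<omega> * w \<omega>)) / (real k)\<^sup>2)"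
      by (intro Bochner_Integration.integral_cong refl)
         (simp add: \<xi>_def u_def w_def power_divide power2_eq_square algebra_simps)
    also have "\<dots> = 2 * (\<integral>x. (x - \<mu>)\<^sup>2 \<partial>\<nu>) / (real k)\<^sup>2"
      using cross uw E_uw by simp
    finally show ?thesis .
  qed

  \<comment> \<open>The mean depends on the first k coordinates only, so its moment can be computed
    on the doubled space.\<close>
  have distr_restrict: "distr \<Omega> (PiM {1..k} (\<lambda>_. borel)) (\<lambda>\<omega>. \<lambda>i\<in>{1..k}. \<omega> i) = PiM {1..k} (\<lambda>_. \<nu>)"
    using k in_range
    by (intro \<Omega>.joint_distr_iid \<Omega>.indep_vars_subset[OF ind] distr_coord) auto
  have "(\<integral>\<omega>. \<bar>\<Sum>j=1..k. (\<omega> j - \<mu>) / k\<bar> powr q \<partial>PiM {1..k} (\<lambda>_. \<nu>)) = \<Omega>.expectation (\<lambda>\<omega>. \<bar>S \<omega>\<bar> powr q)"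
    unfolding distr_restrict[symmetric]
  proof (subst integral_distr)
    show "(\<lambda>\<omega>. \<lambda>i\<in>{1..k}. \<omega> i) \<in> \<Omega> \<rightarrow>\<^sub>M PiM {1..k} (\<lambda>_. borel)"
      using in_range coord by (intro measurable_restrict) auto
  qed (auto simp: S_def)
  also have "\<dots> \<le> \<Omega>.expectation (\<lambda>\<omega>. \<bar>S \<omega> - S' \<omega>\<bar> powr q)"
  proof (rule \<Omega>.expectation_abs_powr_le_diff)
    have "\<Omega>.indep_var borel ((\<lambda>f. \<Sum>j=1..k. (f j - \<mu>) / k) \<circ> (\<lambda>\<omega>. restrict (\<lambda>i. \<omega> i) {1..k}))
        borel ((\<lambda>f. \<Sum>j=1..k. (f (k + j) - \<mu>) / k) \<circ> (\<lambda>\<omega>. restrict (\<lambda>i. \<omega> i) {k + 1..2 * k}))"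
      using k by (intro \<Omega>.indep_var_compose[OF \<Omega>.indep_var_restrict[OF ind]] borel_measurable_sum) auto
    then show "\<Omega>.indep_var borel S borel S'"
      by (simp add: comp_def S_def S'_def)
    have sum_int: "integrable \<Omega> (\<lambda>\<omega>. \<bar>\<Sum>j\<in>J. (\<omega> j - \<mu>) / k\<bar> powr q)" if "finite J" "J \<subseteq> {1..2 * k}" for J
      using that
    proof (induction J)
      case empty
      then show ?case by simp
    next
      case (insert j J)
      have "integrable \<Omega> (\<lambda>\<omega>. \<bar>(\<Sum>j\<in>J. (\<omega> j - \<mu>) / k) + (\<omega> j - \<mu>) / k\<bar> powr q)"
        using insert q integrable_coord[of j "\<lambda>x. \<bar>(x - \<mu>) / k\<bar> powr q"] intck
        by (intro \<Omega>.integrable_abs_add_powr borel_measurable_sum borel_measurable_divide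
            borel_measurable_diff borel_measurable_const coord) auto
      then show ?case
        using insert by (simp add: add.commute)
    qed
    show "integrable \<Omega> (\<lambda>\<omega>. \<bar>S \<omega>\<bar> powr q)"
      unfolding S_def by (rule sum_int) auto
    have "S' = (\<lambda>\<omega>. \<Sum>j\<in>(+) k ` {1..k}. (\<omega> j - \<mu>) / k)"
      by (subst sum.reindex) (auto simp: S'_def)
    then show "integrable \<Omega> (\<lambda>\<omega>. \<bar>S' \<omega>\<bar> powr q)"
      using sum_int[of "(+) k ` {1..k}"] by (auto simp: image_subset_iff)
    have f: "(\<lambda>x. (x - \<mu>) / k) \<in> borel_measurable borel"
      by simp
    have \<nu>_f: "integrable \<nu> (\<lambda>x. (x - \<mu>) / k)" "(\<integral>x. (x - \<mu>) / k \<partial>\<nu>) = 0"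
      using intc1 mean0 by simp_all
    have int_c: "integrable \<Omega> (\<lambda>\<omega>. (\<omega> (k + j) - \<mu>) / k)" if "j \<in> {1..k}" for j
      using integrable_coord[OF in_range(2)[OF that] f] \<nu>_f by blast
    show "integrable \<Omega> S'"
      unfolding S'_def by (intro Bochner_Integration.integrable_sum int_c)
    have "\<Omega>.expectation S' = (\<Sum>j=1..k. \<Omega>.expectation (\<lambda>\<omega>. (\<omega> (k + j) - \<mu>) / k))"
      unfolding S'_def by (rule Bochner_Integration.integral_sum[OF int_c])
    also have "\<dots> = 0"
      by (intro sum.neutral ballI integral_coord[OF in_range(2) f, unfolded \<nu>_f(2)])
    finally show "\<Omega>.expectation S' = 0" .
  qed (use q in auto)
  also have "\<dots> = \<Omega>.expectation (\<lambda>\<omega>. \<bar>\<Sum>j=1..k. \<xi> j \<omega>\<bar> powr q)"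
  proof -
    have "S \<omega> - S' \<omega> = (\<Sum>j=1..k. \<xi> j \<omega>)" for \<omega>
      unfolding S_def S'_def sum_subtractf[symmetric] by (intro sum.cong) (auto simp: \<xi>_def field_simps)
    then show ?thesis
      by simp
  qed
  also have "\<dots> \<le> rosenthal_const q \<gamma> *
      max (\<gamma> * (\<Sum>i=1..k. \<Omega>.expectation (\<lambda>\<omega>. \<bar>\<xi> i \<omega>\<bar> powr q)))
          (sqrt (\<Sum>i=1..k. \<Omega>.expectation (\<lambda>\<omega>. (\<xi> i \<omega>)\<^sup>2)) powr q)"
    by (rule rosenthal_inequality_rosenthal_const[OF q \<gamma>, unfolded rosenthal_inequality_def, rule_format])
       (use k \<xi>_ind \<xi>_sym \<xi>_moment in \<open>auto intro: \<Omega>.prob_space_axioms\<close>)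
  also have "\<dots> \<le> rosenthal_const q \<gamma> *
      max (2 powr q * \<gamma> * k * (\<integral>x. \<bar>(x - \<mu>) / k\<bar> powr q \<partial>\<nu>))
          (sqrt (2 * (\<integral>x. (x - \<mu>)\<^sup>2 \<partial>\<nu>) / k) powr q)"
  proof (intro mult_left_mono max.mono)
    have "(\<Sum>i=1..k. \<Omega>.expectation (\<lambda>\<omega>. \<bar>\<xi> i \<omega>\<bar> powr q)) \<le> (\<Sum>i=1..k. 2 powr q * (\<integral>x. \<bar>(x - \<mu>) / k\<bar> powr q \<partial>\<nu>))"
      by (intro sum_mono \<xi>_moment)
    then show "\<gamma> * (\<Sum>i=1..k. \<Omega>.expectation (\<lambda>\<omega>. \<bar>\<xi> i \<omega>\<bar> powr q))
        \<le> 2 powr q * \<gamma> * k * (\<integral>x. \<bar>(x - \<mu>) / k\<bar> powr q \<partial>\<nu>)"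
      using \<gamma> mult_left_mono[of _ _ \<gamma>] by (fastforce simp: mult_ac)
    show "sqrt (\<Sum>i=1..k. \<Omega>.expectation (\<lambda>\<omega>. (\<xi> i \<omega>)\<^sup>2)) powr q
        \<le> sqrt (2 * (\<integral>x. (x - \<mu>)\<^sup>2 \<partial>\<nu>) / k) powr q"
    proof -
      have "(\<Sum>i=1..k. \<Omega>.expectation (\<lambda>\<omega>. (\<xi> i \<omega>)\<^sup>2)) = (\<Sum>i=1..k. 2 * (\<integral>x. (x - \<mu>)\<^sup>2 \<partial>\<nu>) / (real k)\<^sup>2)"
        by (intro sum.cong \<xi>_square refl)
      also have "\<dots> = 2 * (\<integral>x. (x - \<mu>)\<^sup>2 \<partial>\<nu>) / k"
        using k by (simp add: power2_eq_square[of "real k"])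
      finally show ?thesis
        by simp
    qed
    show "0 \<le> rosenthal_const q \<gamma>"
      using rosenthal_inequality_nonneg[OF rosenthal_inequality_rosenthal_const[OF q \<gamma>]] .
  qed
  finally show ?thesis .
qed

section \<open>The leave-p-out estimator as a U-statistic\<close>

text \<open>The kernel is indexed by an arbitrary set instead of an initial segment, so that
  permutations can act on the index set. Its symmetry is built in because \<open>subsample\<close>
  forgets the order.\<close>

definition loo_on :: "'d rule \<Rightarrow> nat set \<Rightarrow> (nat \<Rightarrow> (real ^ 'd) \<times> nat) \<Rightarrow> real" where
  "loo_on A s z =
     (\<Sum>i\<in>s. of_bool (A (subsample z (s - {i})) (fst (z i)) \<noteq> snd (z i))) / real (card s)"

text \<open>Boundedness is the source of integrability in the final proof. For empty or infinite
  \<open>s\<close> the quotient is 0 by the conventions on division, sums and cardinality.\<close>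

lemma loo_on_bounds: "0 \<le> loo_on A s z" "loo_on A s z \<le> 1"
proof -
  have "(\<Sum>i\<in>s. of_bool (A (subsample z (s - {i})) (fst (z i)) \<noteq> snd (z i))) \<le> (\<Sum>i\<in>s. 1 :: real)"
    by (intro sum_mono) simp
  then show "loo_on A s z \<le> 1"
    by (auto simp: loo_on_def divide_le_eq_1)
qed (auto simp: loo_on_def intro!: divide_nonneg_nonneg sum_nonneg)

text \<open>This locality makes kernel values over disjoint index sets functions of disjoint groups
  of observations, hence independent.\<close>

lemma loo_on_cong:
  assumes "finite s" "\<And>i. i \<in> s \<Longrightarrow> z i = z' i"
  shows "loo_on A s z = loo_on A s z'"
proof -
  have "subsample z (s - {i}) = subsample z' (s - {i})" for i
    unfolding subsample_def using assms by (intro image_mset_cong) auto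
  then show ?thesis
    unfolding loo_on_def using assms by (intro arg_cong2[where f = "(/)"] sum.cong) auto
qed

lemma loo_on_image:
  assumes "inj_on f s"
  shows "loo_on A (f ` s) z = loo_on A s (z \<circ> f)"
proof -
  have "subsample z (f ` s - {f i}) = subsample (z \<circ> f) (s - {i})" if "i \<in> s" for i
  proof -
    have "f ` s - {f i} = f ` (s - {i})"
      using assms that by (auto simp: inj_on_def)
    moreover have "inj_on f (s - {i})"
      using assms by (rule inj_on_subset) auto
    ultimately show ?thesis
      by (simp add: subsample_def image_mset_mset_set[symmetric] multiset.map_comp)
  qed
  then show ?thesis
    unfolding loo_on_def card_image[OF assms] sum.reindex[OF assms]
    by (intro arg_cong2[where f = "(/)"] sum.cong) auto
qed

lemma lpo_eq_average_loo_on: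
  assumes "1 \<le> p" "p \<le> n"
  shows "lpo A p n z = (\<Sum>s | s \<subseteq> {1..n} \<and> card s = n - p + 1. loo_on A s z) / real (n choose (n - p + 1))"
proof -
  define F where "F = (\<lambda>e i. of_bool (A (subsample z e) (fst (z i)) \<noteq> snd (z i)) :: real)"
  define \<E> where "\<E> = {e. e \<subseteq> {1..n} \<and> card e = n - p}"
  define \<S> where "\<S> = {s. s \<subseteq> {1..n} \<and> card s = n - p + 1}"
  have fin: "finite \<E>" "finite \<S>" "\<And>e. e \<in> \<E> \<Longrightarrow> finite e" "\<And>s. s \<in> \<S> \<Longrightarrow> finite s"
    unfolding \<E>_def \<S>_def using finite_subset[OF _ finite_atLeastAtMost[of 1 n]] by auto
  have "(\<Sum>e\<in>\<E>. \<Sum>i\<in>{1..n} - e. F e i) = (\<Sum>(e, i)\<in>(SIGMA e:\<E>. {1..n} - e). F e i)"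
    using fin by (subst sum.Sigma) auto
  also have "\<dots> = (\<Sum>(s, i)\<in>(SIGMA s:\<S>. s). F (s - {i}) i)"
  proof (rule sum.reindex_bij_witness[where i = "\<lambda>(s, i). (s - {i}, i)" and j = "\<lambda>(e, i). (insert i e, i)"])
    fix a assume "a \<in> (SIGMA e:\<E>. {1..n} - e)"
    then obtain e i where a: "a = (e, i)" "e \<in> \<E>" "i \<in> {1..n}" "i \<notin> e"
      by blast
    moreover have "insert i e \<in> \<S>"
      using a fin(3)[OF a(2)] by (simp add: \<E>_def \<S>_def)
    moreover have "insert i e - {i} = e"
      using a by blast
    ultimately show "(case case a of (e, i) \<Rightarrow> (insert i e, i) of (s, i) \<Rightarrow> (s - {i}, i)) = a"
      "(case a of (e, i) \<Rightarrow> (insert i e, i)) \<in> (SIGMA s:\<S>. s)"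
      "(case case a of (e, i) \<Rightarrow> (insert i e, i) of (s, i) \<Rightarrow> F (s - {i}) i) = (case a of (e, i) \<Rightarrow> F e i)"
      by simp_all
  next
    fix b assume "b \<in> (SIGMA s:\<S>. s)"
    then obtain s i where b: "b = (s, i)" "s \<in> \<S>" "i \<in> s"
      by blast
    moreover have "s - {i} \<in> \<E>"
      using b fin(4)[OF b(2)] by (auto simp: \<E>_def \<S>_def card_Diff_singleton)
    moreover have "insert i (s - {i}) = s" "i \<in> {1..n}"
      using b by (auto simp: \<S>_def)
    ultimately show "(case case b of (s, i) \<Rightarrow> (s - {i}, i) of (e, i) \<Rightarrow> (insert i e, i)) = b"
      "(case b of (s, i) \<Rightarrow> (s - {i}, i)) \<in> (SIGMA e:\<E>. {1..n} - e)"
      by simp_all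
  qed
  also have "\<dots> = (\<Sum>s\<in>\<S>. \<Sum>i\<in>s. F (s - {i}) i)"
    using fin by (subst sum.Sigma) auto
  also have "\<dots> = (\<Sum>s\<in>\<S>. real (n - p + 1) * loo_on A s z)"
    by (intro sum.cong) (auto simp: \<S>_def loo_on_def F_def)
  finally have main: "(\<Sum>e\<in>\<E>. \<Sum>i\<in>{1..n} - e. F e i) = real (n - p + 1) * (\<Sum>s\<in>\<S>. loo_on A s z)"
    by (simp add: sum_distrib_left)
  \<comment> \<open>Matching the normalisations: \<open>p * (n choose p)\<close> and
    \<open>(n - p + 1) * (n choose (n - p + 1))\<close> both equal
    \<open>n * ((n - 1) choose (p - 1))\<close>, which counts the pairs by choosing the test point
    first.\<close>
  have "(n - 1) choose (p - 1) = (n - 1) choose (n - p)"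
    using assms binomial_symmetric[of "p - 1" "n - 1"] by simp
  then have "p * (n choose p) = (n - p + 1) * (n choose (n - p + 1))"
    using assms times_binomial_minus1_eq[of p n] times_binomial_minus1_eq[of "n - p + 1" n] by simp
  then have "real p * real (n choose p) = real (n - p + 1) * real (n choose (n - p + 1))"
    by (metis of_nat_mult)
  note choose = this
  have pos: "n choose p > 0" "n choose (n - p + 1) > 0" "p > 0" "n - p + 1 > 0"
    using assms by (auto simp: zero_less_binomial_iff)
  have "lpo A p n z = (\<Sum>e\<in>\<E>. \<Sum>i\<in>{1..n} - e. F e i) / (real p * real (n choose p))"
    unfolding lpo_def \<E>_def F_def sum_distrib_left[symmetric] by (simp only: divide_inverse mult_ac) simp
  also have "\<dots> = (\<Sum>s\<in>\<S>. loo_on A s z) / real (n choose (n - p + 1))"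
    unfolding main choose using pos by (simp del: of_nat_add of_nat_Suc)
  finally show ?thesis
    by (simp add: \<S>_def)
qed

lemma lpo_one_eq_loo_on:
  assumes "1 \<le> m"
  shows "lpo A 1 m z = loo_on A {1..m} z"
proof -
  have "{s. s \<subseteq> {1..m} \<and> card s = m} = {{1..m}}"
    using card_subset_eq[of "{1..m}"] by auto
  then show ?thesis
    using assms lpo_eq_average_loo_on[of 1 m A z] by simp
qed

text \<open>Transitivity of the permutations of \<open>N\<close> on subsets of a given size: a
  bijection from \<open>B\<close> to \<open>s\<close> is glued to one between the
  complements.\<close>

lemma permutes_extending_equal_card:
  assumes "finite N" "B \<subseteq> N" "s \<subseteq> N" "card B = card s"
  obtains \<tau> where "\<tau> permutes N" "\<tau> ` B = s"
proof -
  have "finite B" "finite s"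
    using finite_subset[OF assms(2,1)] finite_subset[OF assms(3,1)] .
  then obtain f where f: "bij_betw f B s"
    using finite_same_card_bij[of B s] assms(4) by blast
  have "card (N - B) = card (N - s)"
    using assms \<open>finite B\<close> \<open>finite s\<close> by (simp add: card_Diff_subset)
  then obtain g where g: "bij_betw g (N - B) (N - s)"
    using finite_same_card_bij[of "N - B" "N - s"] assms(1) by blast
  define \<tau> where "\<tau> = (\<lambda>x. if x \<in> B then f x else if x \<in> N then g x else x)"
  have 1: "bij_betw \<tau> B s"
    using f by (subst bij_betw_cong[of _ _ f]) (auto simp: \<tau>_def)
  have 2: "bij_betw \<tau> (N - B) (N - s)"
    using g by (subst bij_betw_cong[of _ _ g]) (auto simp: \<tau>_def)
  have "bij_betw \<tau> (B \<union> (N - B)) (s \<union> (N - s))"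
    by (rule bij_betw_combine[OF 1 2]) auto
  moreover have "B \<union> (N - B) = N" "s \<union> (N - s) = N"
    using assms by auto
  ultimately have "\<tau> permutes N"
    by (intro bij_imp_permutes) (use assms in \<open>auto simp: \<tau>_def\<close>)
  then show thesis
    using that bij_betw_imp_surj_on[OF 1] by blast
qed

text \<open>Double counting without computing stabilisers. The sum \<open>G s\<close> over all
  permutations is the same for every \<open>s\<close>, by composition with a permutation carrying
  \<open>B\<close> to \<open>s\<close>. Summing \<open>G\<close> over all \<open>s\<close> and
  exchanging the sums leaves, for each permutation, a mere rearrangement of the family of
  subsets.\<close>

lemma sum_subsets_eq_sum_permutations:
  fixes F :: "'a set \<Rightarrow> real"
  assumes N: "finite N" and B: "B \<subseteq> N"
  shows "(\<Sum>s | s \<subseteq> N \<and> card s = card B. F s) / real (card N choose card B)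
       = (\<Sum>\<sigma> | \<sigma> permutes N. F (\<sigma> ` B)) / fact (card N)"
proof -
  define \<S> where "\<S> = {s. s \<subseteq> N \<and> card s = card B}"
  define G where "G = (\<lambda>s. \<Sum>\<sigma> | \<sigma> permutes N. F (\<sigma> ` s))"
  have card_\<S>: "card \<S> = card N choose card B"
    using n_subsets[OF N] by (simp add: \<S>_def)
  have "G s = G B" if "s \<in> \<S>" for s
  proof -
    have "s \<subseteq> N" "card B = card s"
      using that by (auto simp: \<S>_def)
    then obtain \<tau> where \<tau>: "\<tau> permutes N" "\<tau> ` B = s"
      using permutes_extending_equal_card[OF N B] by blast
    have "G B = (\<Sum>\<sigma> | \<sigma> permutes N. F ((\<sigma> \<circ> \<tau>) ` B))"
      unfolding G_def by (rule sum_permutations_compose_right[OF \<tau>(1)])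
    then show ?thesis
      by (simp add: G_def \<tau>(2)[symmetric] image_comp)
  qed
  then have "real (card N choose card B) * G B = (\<Sum>s\<in>\<S>. G s)"
    by (simp add: card_\<S>)
  also have "\<dots> = (\<Sum>\<sigma> | \<sigma> permutes N. \<Sum>s\<in>\<S>. F (\<sigma> ` s))"
    unfolding G_def by (rule sum.swap)
  also have "\<dots> = (\<Sum>\<sigma> | \<sigma> permutes N. \<Sum>s\<in>\<S>. F s)"
  proof (rule sum.cong[OF refl])
    fix \<sigma> assume "\<sigma> \<in> {\<sigma>. \<sigma> permutes N}"
    then have \<sigma>: "\<sigma> permutes N"
      by simp
    have maps: "\<pi> ` s \<in> \<S>" if "\<pi> permutes N" "s \<in> \<S>" for \<pi> s
      using that permutes_image[OF that(1)] card_image[OF permutes_inj_on[OF that(1)]]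
      by (auto simp: \<S>_def)
    show "(\<Sum>s\<in>\<S>. F (\<sigma> ` s)) = (\<Sum>s\<in>\<S>. F s)"
      by (rule sum.reindex_bij_witness[where i = "\<lambda>s. inv \<sigma> ` s" and j = "\<lambda>s. \<sigma> ` s"])
         (use \<sigma> permutes_inv[OF \<sigma>] maps in
           \<open>auto simp: image_comp permutes_inv_o[OF \<sigma>]\<close>)
  qed
  also have "\<dots> = fact (card N) * (\<Sum>s\<in>\<S>. F s)"
    by (simp add: card_permutations[OF refl N])
  finally have "real (card N choose card B) * G B = fact (card N) * (\<Sum>s\<in>\<S>. F s)" .
  moreover have "real (card N choose card B) > 0"
    using card_mono[OF N B] by (simp add: zero_less_binomial_iff)
  ultimately show ?thesis
    by (simp add: G_def \<S>_def field_simps)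
qed

section \<open>Moments of averages\<close>

text \<open>Jensen's inequality with equal weights, applied pointwise. It is insensitive to
  dependence between the \<open>V i\<close>, so kernels over overlapping index sets can be
  averaged.\<close>

lemma (in prob_space) expectation_abs_powr_average_le:
  fixes V :: "'i \<Rightarrow> 'a \<Rightarrow> real"
  assumes I: "finite I" "I \<noteq> {}" and q: "q \<ge> 1"
    and meas: "\<And>i. i \<in> I \<Longrightarrow> V i \<in> borel_measurable M"
    and int: "\<And>i. i \<in> I \<Longrightarrow> integrable M (\<lambda>\<omega>. \<bar>V i \<omega>\<bar> powr q)"
    and le: "\<And>i. i \<in> I \<Longrightarrow> expectation (\<lambda>\<omega>. \<bar>V i \<omega>\<bar> powr q) \<le> c"
  shows "expectation (\<lambda>\<omega>. \<bar>(\<Sum>i\<in>I. V i \<omega>) / card I\<bar> powr q) \<le> c"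
proof -
  have card: "real (card I) > 0"
    using I by (simp add: card_gt_0_iff)
  have bound: "\<bar>(\<Sum>i\<in>I. V i \<omega>) / card I\<bar> powr q \<le> (\<Sum>i\<in>I. 1 / card I * \<bar>V i \<omega>\<bar> powr q)" for \<omega>
    using convex_on_sum[OF I convex_on_abs_powr[OF q], of "\<lambda>_. 1 / card I" "\<lambda>i. V i \<omega>"] card
    by (simp add: sum_divide_distrib)
  have "expectation (\<lambda>\<omega>. \<bar>(\<Sum>i\<in>I. V i \<omega>) / card I\<bar> powr q)
      \<le> expectation (\<lambda>\<omega>. \<Sum>i\<in>I. 1 / card I * \<bar>V i \<omega>\<bar> powr q)"
    by (intro integral_mono' bound Bochner_Integration.integrable_sum integrable_mult_right int)
       (auto intro!: sum_nonneg)
  also have "\<dots> = (\<Sum>i\<in>I. 1 / card I * expectation (\<lambda>\<omega>. \<bar>V i \<omega>\<bar> powr q))"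
    using int by (subst Bochner_Integration.integral_sum) auto
  also have "\<dots> \<le> (\<Sum>i\<in>I. 1 / card I * c)"
    using le card by (intro sum_mono mult_left_mono) auto
  also have "\<dots> = c"
    using card by simp
  finally show ?thesis .
qed

text \<open>The mixed terms vanish by independence and centring. Integrability belongs to the
  induction claim because splitting the expectation of the expanded square requires it.\<close>

lemma (in prob_space) expectation_square_sum_indep:
  fixes V :: "'i \<Rightarrow> 'a \<Rightarrow> real"
  assumes "finite I" "indep_vars (\<lambda>_. borel) V I"
    and "\<And>i. i \<in> I \<Longrightarrow> integrable M (V i)" "\<And>i. i \<in> I \<Longrightarrow> integrable M (\<lambda>\<omega>. (V i \<omega>)\<^sup>2)"
    and "\<And>i. i \<in> I \<Longrightarrow> expectation (V i) = 0"
  shows "integrable M (\<lambda>\<omega>. (\<Sum>i\<in>I. V i \<omega>)\<^sup>2)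
    \<and> expectation (\<lambda>\<omega>. (\<Sum>i\<in>I. V i \<omega>)\<^sup>2) = (\<Sum>i\<in>I. expectation (\<lambda>\<omega>. (V i \<omega>)\<^sup>2))"
  using assms
proof (induction I)
  case (insert i I)
  define S where "S = (\<lambda>\<omega>. \<Sum>i\<in>I. V i \<omega>)"
  have IH: "integrable M (\<lambda>\<omega>. (S \<omega>)\<^sup>2)"
    "expectation (\<lambda>\<omega>. (S \<omega>)\<^sup>2) = (\<Sum>i\<in>I. expectation (\<lambda>\<omega>. (V i \<omega>)\<^sup>2))"
    using insert indep_vars_subset[of "\<lambda>_. borel" V "insert i I" I] by (auto simp: S_def)
  have ind: "indep_var borel (V i) borel S"
    unfolding S_def by (rule indep_vars_sum) (use insert in auto)
  have V: "integrable M (V i)" "integrable M (\<lambda>\<omega>. (V i \<omega>)\<^sup>2)" "expectation (V i) = 0"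
    using insert by auto
  have S: "integrable M S"
    unfolding S_def using insert by (intro Bochner_Integration.integrable_sum) auto
  note cross = indep_var_lebesgue_integral[OF ind V(1) S] indep_var_integrable[OF ind V(1) S]
  have eq: "(\<Sum>j\<in>insert i I. V j \<omega>)\<^sup>2 = (V i \<omega>)\<^sup>2 + (S \<omega>)\<^sup>2 + 2 * (V i \<omega> * S \<omega>)" for \<omega>
    using insert by (simp add: S_def power2_sum)
  show ?case
    unfolding eq using cross V IH insert by simp
qed simp

text \<open>The map \<open>f\<close> enumerates the index set, and the kernel there equals the
  kernel on \<open>{1..m}\<close> applied to the tuple of the \<open>Z (f i)\<close>. That tuple has
  a product law not depending on \<open>f\<close>, so both law and measurability reduce to the
  single case \<open>{1..m}\<close>.\<close>

lemma (in prob_space) loo_on_distr: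
  fixes A :: "'d::finite rule" and Z :: "nat \<Rightarrow> 'a \<Rightarrow> (real ^ 'd) \<times> nat"
  assumes ind: "indep_vars (\<lambda>_. S) Z {1..n}" and P: "\<And>i. i \<in> {1..n} \<Longrightarrow> distr M S (Z i) = P"
    and h: "loo_on A {1..m} \<in> borel_measurable (PiM {1..m} (\<lambda>_. S))"
    and m: "1 \<le> m" and f: "inj_on f {1..m}" "f ` {1..m} \<subseteq> {1..n}"
  shows "distr M borel (\<lambda>\<omega>. loo_on A (f ` {1..m}) (\<lambda>i. Z i \<omega>))
           = distr (PiM {1..m} (\<lambda>_. P)) borel (loo_on A {1..m})"
    and "(\<lambda>\<omega>. loo_on A (f ` {1..m}) (\<lambda>i. Z i \<omega>)) \<in> borel_measurable M"
    and "loo_on A (f ` {1..m}) \<in> borel_measurable (PiM (f ` {1..m}) (\<lambda>_. S))"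
proof -
  have f_in: "f i \<in> {1..n}" if "i \<in> {1..m}" for i
    using f that by blast
  have ne: "{1..n} \<noteq> {}" and one: "1 \<in> {1..n}"
    using f_in[of 1] m by auto
  have Z_meas: "Z i \<in> M \<rightarrow>\<^sub>M S" if "i \<in> {1..n}" for i
    using ind that by (auto simp: indep_vars_def)
  have P_prob: "prob_space P"
    using prob_space_distr[OF Z_meas[OF one]] P[OF one] by simp
  have sets_P: "sets P = sets S"
    using P[OF one] by (metis sets_distr)
  have sets_PiM: "sets (PiM I (\<lambda>_. P)) = sets (PiM I (\<lambda>_. S))" for I :: "nat set"
    by (intro sets_PiM_cong) (auto simp: sets_P)
  have joint: "distr M (PiM {1..m} (\<lambda>_. S)) (\<lambda>\<omega>. \<lambda>i\<in>{1..m}. Z (f i) \<omega>) = PiM {1..m} (\<lambda>_. P)"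
  proof -
    have "PiM {1..m} (\<lambda>_. P) = distr (PiM {1..n} (\<lambda>_. P)) (PiM {1..m} (\<lambda>_. P)) (\<lambda>\<omega>. \<lambda>i\<in>{1..m}. \<omega> (f i))"
      by (rule distr_PiM_reindex[of "{1..n}" "\<lambda>_. P", symmetric]) (use f f_in P_prob in auto)
    also have "\<dots> = distr (PiM {1..n} (\<lambda>_. P)) (PiM {1..m} (\<lambda>_. S)) (\<lambda>\<omega>. \<lambda>i\<in>{1..m}. \<omega> (f i))"
      by (intro distr_cong) (auto simp: sets_PiM)
    also have "\<dots> = distr (distr M (PiM {1..n} (\<lambda>_. S)) (\<lambda>\<omega>. \<lambda>i\<in>{1..n}. Z i \<omega>)) (PiM {1..m} (\<lambda>_. S))
        (\<lambda>\<omega>. \<lambda>i\<in>{1..m}. \<omega> (f i))"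
      by (simp only: joint_distr_iid[OF ind ne P])
    also have "\<dots> = distr M (PiM {1..m} (\<lambda>_. S)) ((\<lambda>\<omega>. \<lambda>i\<in>{1..m}. \<omega> (f i)) \<circ> (\<lambda>\<omega>. \<lambda>i\<in>{1..n}. Z i \<omega>))"
      by (intro distr_distr measurable_restrict measurable_component_singleton f_in Z_meas)
    also have "(\<lambda>\<omega>. \<lambda>i\<in>{1..m}. \<omega> (f i)) \<circ> (\<lambda>\<omega>. \<lambda>i\<in>{1..n}. Z i \<omega>) = (\<lambda>\<omega>. \<lambda>i\<in>{1..m}. Z (f i) \<omega>)"
      using f_in by (intro ext) (simp add: restrict_def)
    finally show ?thesis ..
  qed
  have eq: "loo_on A (f ` {1..m}) z = loo_on A {1..m} (\<lambda>i\<in>{1..m}. z (f i))" for z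
    unfolding loo_on_image[OF f(1)] by (intro loo_on_cong) auto
  have Zf: "(\<lambda>\<omega>. \<lambda>i\<in>{1..m}. Z (f i) \<omega>) \<in> M \<rightarrow>\<^sub>M PiM {1..m} (\<lambda>_. S)"
    by (intro measurable_restrict Z_meas f_in)
  show "distr M borel (\<lambda>\<omega>. loo_on A (f ` {1..m}) (\<lambda>i. Z i \<omega>))
           = distr (PiM {1..m} (\<lambda>_. P)) borel (loo_on A {1..m})"
    unfolding eq joint[symmetric] distr_distr[OF h Zf] by (simp add: comp_def)
  show "(\<lambda>\<omega>. loo_on A (f ` {1..m}) (\<lambda>i. Z i \<omega>)) \<in> borel_measurable M"
    unfolding eq by (rule measurable_compose[OF Zf h])
  show "loo_on A (f ` {1..m}) \<in> borel_measurable (PiM (f ` {1..m}) (\<lambda>_. S))"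
    unfolding eq by (rule measurable_compose[OF _ h]) (intro measurable_restrict measurable_component_singleton imageI)
qed

section \<open>The moment inequalities\<close>

theorem theorem2p2:
  fixes M :: "'w measure"
    and X :: "(real ^ 'd) set"
    and P :: "((real ^ 'd) \<times> nat) measure"
    and Z :: "nat \<Rightarrow> 'w \<Rightarrow> (real ^ 'd) \<times> nat"
    and A :: "'d rule"
    and n p m :: nat
    and Rpn R1m :: "'w \<Rightarrow> real"
  assumes "prob_space M"
    and "iid M (observations X) P Z {1..n}"
    and "classification_rule X A"
    and "1 \<le> p" and "p \<le> n - 1"
    and "m = n - p + 1"
    and "lpo_well_defined X A p n" and "lpo_well_defined X A 1 m"
    and "Rpn = (\<lambda>\<omega>. lpo A p n (\<lambda>i. Z i \<omega>))"
    and "R1m = (\<lambda>\<omega>. lpo A 1 m (\<lambda>i. Z i \<omega>))"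
  shows "(\<forall>q::real. q \<ge> 1 \<longrightarrow>
            prob_space.expectation M (\<lambda>\<omega>. \<bar>Rpn \<omega> - prob_space.expectation M Rpn\<bar> powr q)
              \<le> prob_space.expectation M (\<lambda>\<omega>. \<bar>R1m \<omega> - prob_space.expectation M R1m\<bar> powr q))
       \<and> (real p > real n / 2 + 1 \<longrightarrow>
            prob_space.expectation M (\<lambda>\<omega>. \<bar>Rpn \<omega> - prob_space.expectation M Rpn\<bar>\<^sup>2)
              \<le> prob_space.expectation M (\<lambda>\<omega>. \<bar>R1m \<omega> - prob_space.expectation M R1m\<bar>\<^sup>2)
                  / real_of_int \<lfloor>real n / real m\<rfloor>
          \<and> (\<forall>q::real. \<forall>\<gamma>::real. q > 2 \<longrightarrow> \<gamma> > 0 \<longrightarrow>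
               prob_space.expectation M (\<lambda>\<omega>. \<bar>Rpn \<omega> - prob_space.expectation M Rpn\<bar> powr q)
                 \<le> rosenthal_const q \<gamma> *
                    max (2 powr q * \<gamma> * real_of_int \<lfloor>real n / real m\<rfloor> *
                           prob_space.expectation M
                             (\<lambda>\<omega>. \<bar>(R1m \<omega> - prob_space.expectation M R1m)
                                     / real_of_int \<lfloor>real n / real m\<rfloor>\<bar> powr q))
                        (sqrt (2 * prob_space.variance M R1m
                                / real_of_int \<lfloor>real n / real m\<rfloor>) powr q)))"
proof -
  interpret prob_space M by fact
  define S where "S = observations X"
  have ind: "indep_vars (\<lambda>_. S) Z {1..n}" and P: "\<And>i. i \<in> {1..n} \<Longrightarrow> distr M S (Z i) = P"
    using assms(2) by (auto simp: iid_def S_def)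
  have m: "1 \<le> m" "m \<le> n" and pn: "1 \<le> p" "p \<le> n"
    using assms(4-6) by auto
  have h: "loo_on A {1..m} \<in> borel_measurable (PiM {1..m} (\<lambda>_. S))"
  proof -
    have "lpo A 1 m = loo_on A {1..m}"
      using lpo_one_eq_loo_on[OF m(1)] by (intro ext)
    then show ?thesis
      using assms(8) by (simp add: lpo_well_defined_def S_def)
  qed
  define H where "H = (\<lambda>s \<omega>. loo_on A s (\<lambda>i. Z i \<omega>))"
  \<comment> \<open>The law shared by all \<open>H s\<close> with \<open>s\<close> of size
    \<open>m\<close>; moments over different index sets are compared through it.\<close>
  define \<nu> where "\<nu> = distr (PiM {1..m} (\<lambda>_. P)) borel (loo_on A {1..m})"
  have R1m: "R1m = H {1..m}"
    unfolding assms(10) H_def lpo_one_eq_loo_on[OF m(1)] ..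
  have Rpn: "Rpn \<omega> = (\<Sum>s | s \<subseteq> {1..n} \<and> card s = m. H s \<omega>) / (n choose m)" for \<omega>
    using assms(6,9) by (simp add: H_def lpo_eq_average_loo_on[OF pn])
  have H_distr: "distr M borel (H s) = \<nu>" and H_meas: "H s \<in> borel_measurable M"
    and loo_meas: "loo_on A s \<in> borel_measurable (PiM s (\<lambda>_. S))"
    if s: "s \<subseteq> {1..n}" "card s = m" for s
  proof -
    have "finite s"
      using s(1) finite_subset by blast
    then obtain f where "bij_betw f {1..m} s"
      using s(2) finite_same_card_bij[of "{1..m}" s] by auto
    then have f: "inj_on f {1..m}" "f ` {1..m} = s"
      by (auto simp: bij_betw_def)
    note * = loo_on_distr[OF ind P h m(1) f(1), unfolded f(2), OF _ s(1)]
    show "distr M borel (H s) = \<nu>" "H s \<in> borel_measurable M" "loo_on A s \<in> borel_measurable (PiM s (\<lambda>_. S))"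
      using * unfolding H_def \<nu>_def by simp_all
  qed
  have H_bounds: "0 \<le> H s \<omega>" "H s \<omega> \<le> 1" for s \<omega>
    unfolding H_def by (rule loo_on_bounds)+
  have R1m_distr: "distr M borel R1m = \<nu>" and R1m_meas: "R1m \<in> borel_measurable M"
    using m H_distr[of "{1..m}"] H_meas[of "{1..m}"] by (auto simp: R1m)
  have \<nu>_prob: "prob_space \<nu>"
    unfolding R1m_distr[symmetric] by (rule prob_space_distr[OF R1m_meas])
  have E_\<nu>: "(\<integral>x. g x \<partial>\<nu>) = expectation (\<lambda>\<omega>. g (H s \<omega>))"
    if "s \<subseteq> {1..n}" "card s = m" "g \<in> borel_measurable borel" for s and g :: "real \<Rightarrow> real"
    using integral_distr[OF H_meas[OF that(1,2)] that(3)] by (simp add: H_distr[OF that(1,2)])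
  \<comment> \<open>The mean of every kernel value, hence of both estimators: one centring serves
    throughout.\<close>
  define \<mu> where "\<mu> = (\<integral>x. x \<partial>\<nu>)"
  have H_int: "integrable M (H s)" if "s \<subseteq> {1..n}" "card s = m" for s
    using H_bounds by (intro integrable_const_bound[where B = 1] H_meas that) (auto simp: abs_le_iff)
  have E_H: "expectation (H s) = \<mu>" if "s \<subseteq> {1..n}" "card s = m" for s
    using E_\<nu>[OF that, of "\<lambda>x. x"] by (simp add: \<mu>_def)
  have E_R1m: "expectation R1m = \<mu>"
    using E_H[of "{1..m}"] m by (simp add: R1m)
  define \<S> where "\<S> = {s. s \<subseteq> {1..n} \<and> card s = m}"
  have card_\<S>: "card \<S> = n choose m" and fin_\<S>: "finite \<S>"
    using n_subsets[of "{1..n}" m] by (auto simp: \<S>_def)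
  have choose_pos: "n choose m > 0"
    using m by (simp add: zero_less_binomial_iff)
  have ne_\<S>: "\<S> \<noteq> {}"
    using card_\<S> choose_pos by auto
  have E_Rpn: "expectation Rpn = \<mu>"
  proof -
    have "expectation Rpn = (\<Sum>s\<in>\<S>. expectation (H s)) / (n choose m)"
      unfolding Rpn \<S>_def[symmetric] by (simp add: \<S>_def H_int)
    also have "(\<Sum>s\<in>\<S>. expectation (H s)) = (\<Sum>s\<in>\<S>. \<mu>)"
      by (intro sum.cong refl E_H) (auto simp: \<S>_def)
    also have "\<dots> / (n choose m) = \<mu>"
      using choose_pos by (simp add: card_\<S>)
    finally show ?thesis .
  qed
  have centred: "\<bar>x - \<mu>\<bar> \<le> 1" if "0 \<le> x" "x \<le> 1" for x
  proof -
    have s: "{1..m} \<subseteq> {1..n}" "card {1..m} = m"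
      using m by auto
    have "0 \<le> \<mu>"
      unfolding E_R1m[symmetric] R1m by (intro integral_nonneg_AE AE_I2 H_bounds)
    moreover have "\<mu> \<le> 1"
      unfolding E_R1m[symmetric] R1m by (intro integral_le_const H_int[OF s] AE_I2 H_bounds)
    ultimately show ?thesis
      using that by (simp add: abs_le_iff)
  qed
  have int_powr: "integrable M (\<lambda>\<omega>. \<bar>V \<omega> - \<mu>\<bar> powr q)"
    if "V \<in> borel_measurable M" "\<And>\<omega>. 0 \<le> V \<omega>" "\<And>\<omega>. V \<omega> \<le> 1" "q \<ge> 0" for V :: "'w \<Rightarrow> real" and q
  proof (rule integrable_const_bound[where B = 1])
    show "(\<lambda>\<omega>. \<bar>V \<omega> - \<mu>\<bar> powr q) \<in> borel_measurable M"
      using that(1) by measurable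
    have "\<bar>V \<omega> - \<mu>\<bar> powr q \<le> 1 powr q" for \<omega>
      using that centred by (intro powr_mono2) auto
    then show "AE \<omega> in M. norm (\<bar>V \<omega> - \<mu>\<bar> powr q) \<le> 1"
      by simp
  qed

  \<comment> \<open>Jensen's inequality over all index sets of size m\<close>
  have part1: "expectation (\<lambda>\<omega>. \<bar>Rpn \<omega> - \<mu>\<bar> powr q) \<le> expectation (\<lambda>\<omega>. \<bar>R1m \<omega> - \<mu>\<bar> powr q)" if "q \<ge> 1" for q
  proof -
    have "Rpn \<omega> - \<mu> = (\<Sum>s\<in>\<S>. H s \<omega> - \<mu>) / card \<S>" for \<omega>
      using choose_pos unfolding Rpn \<S>_def[symmetric] by (simp add: sum_subtractf card_\<S> diff_divide_distrib)
    then have "expectation (\<lambda>\<omega>. \<bar>Rpn \<omega> - \<mu>\<bar> powr q) = expectation (\<lambda>\<omega>. \<bar>(\<Sum>s\<in>\<S>. H s \<omega> - \<mu>) / card \<S>\<bar> powr q)"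
      by simp
    also have "\<dots> \<le> expectation (\<lambda>\<omega>. \<bar>R1m \<omega> - \<mu>\<bar> powr q)"
    proof (rule expectation_abs_powr_average_le[OF fin_\<S> ne_\<S> that])
      fix s assume "s \<in> \<S>"
      then have s: "s \<subseteq> {1..n}" "card s = m"
        by (auto simp: \<S>_def)
      show "(\<lambda>\<omega>. H s \<omega> - \<mu>) \<in> borel_measurable M"
        using H_meas[OF s] by simp
      show "integrable M (\<lambda>\<omega>. \<bar>H s \<omega> - \<mu>\<bar> powr q)"
        using that H_bounds by (intro int_powr H_meas s) auto
      have "expectation (\<lambda>\<omega>. \<bar>H s \<omega> - \<mu>\<bar> powr q) = expectation (\<lambda>\<omega>. \<bar>H {1..m} \<omega> - \<mu>\<bar> powr q)"
        using E_\<nu>[OF s, of "\<lambda>x. \<bar>x - \<mu>\<bar> powr q"] E_\<nu>[of "{1..m}" "\<lambda>x. \<bar>x - \<mu>\<bar> powr q"] m by simp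
      then show "expectation (\<lambda>\<omega>. \<bar>H s \<omega> - \<mu>\<bar> powr q) \<le> expectation (\<lambda>\<omega>. \<bar>R1m \<omega> - \<mu>\<bar> powr q)"
        by (simp add: R1m)
    qed
    finally show ?thesis .
  qed

  \<comment> \<open>Disjoint blocks and their average over permutations\<close>
  define k where "k = n div m"
  have floor: "real_of_int \<lfloor>real n / real m\<rfloor> = real k"
    by (simp add: k_def floor_divide_of_nat_eq)
  have k: "k \<ge> 1"
    using m div_le_mono[of m n m] by (simp add: k_def)
  \<comment> \<open>Consecutive blocks of length \<open>m\<close>; the \<open>n mod m\<close>
    indices left over enter only through the permutations.\<close>
  define B where "B = (\<lambda>j. {(j - 1) * m + 1..j * m})"
  have B: "B j \<subseteq> {1..n}" "card (B j) = m" if "j \<in> {1..k}" for j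
  proof -
    have "j * m \<le> k * m"
      using that by simp
    also have "k * m \<le> n"
      by (simp add: k_def)
    finally show "B j \<subseteq> {1..n}"
      by (auto simp: B_def)
    show "card (B j) = m"
      using that by (cases j) (auto simp: B_def)
  qed
  have B_disjoint: "disjoint_family_on B {1..k}"
  proof -
    have "B i \<inter> B j = {}" if "i < j" for i j
    proof -
      have "i * m \<le> (j - 1) * m"
        using that by (intro mult_right_mono) auto
      then have "x \<notin> B j" if "x \<in> B i" for x
        using that unfolding B_def atLeastAtMost_iff by linarith
      then show ?thesis
        by blast
    qed
    then show ?thesis
      by (metis disjoint_family_on_def Int_commute linorder_neqE_nat)
  qed
  define G where "G = {\<sigma>. \<sigma> permutes {1..n}}"
  have card_G: "card G = fact n" and fin_G: "finite G"
    unfolding G_def using card_permutations[of "{1..n}" n] finite_permutations[of "{1..n}"] by auto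
  have ne_G: "G \<noteq> {}"
    unfolding G_def using permutes_id by blast
  define W where "W = (\<lambda>\<sigma> \<omega>. \<Sum>j=1..k. (H (\<sigma> ` B j) \<omega> - \<mu>) / k)"
  have Rpn_W: "Rpn \<omega> - \<mu> = (\<Sum>\<sigma>\<in>G. W \<sigma> \<omega>) / card G" for \<omega>
  proof -
    \<comment> \<open>The permutation average of one block is already the whole U-statistic, so
      averaging over the k blocks does not change it.\<close>
    have block: "(\<Sum>\<sigma>\<in>G. H (\<sigma> ` B j) \<omega> - \<mu>) = fact n * (Rpn \<omega> - \<mu>)" if "j \<in> {1..k}" for j
    proof -
      have "Rpn \<omega> = (\<Sum>\<sigma>\<in>G. H (\<sigma> ` B j) \<omega>) / fact n"
        using sum_subsets_eq_sum_permutations[of "{1..n}" "B j" "\<lambda>s. H s \<omega>"] B[OF that]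
        by (simp add: Rpn G_def)
      then show ?thesis
        by (simp add: sum_subtractf card_G right_diff_distrib)
    qed
    have "(\<Sum>\<sigma>\<in>G. W \<sigma> \<omega>) = (\<Sum>j=1..k. (\<Sum>\<sigma>\<in>G. H (\<sigma> ` B j) \<omega> - \<mu>) / k)"
      unfolding W_def by (subst sum.swap) (simp add: sum_divide_distrib)
    also have "\<dots> = (\<Sum>j=1..k. fact n * (Rpn \<omega> - \<mu>) / k)"
      by (intro sum.cong refl arg_cong2[where f = "(/)"] block)
    also have "\<dots> = fact n * (Rpn \<omega> - \<mu>)"
      using k by simp
    finally show ?thesis
      by (simp add: card_G)
  qed
  have \<sigma>B: "\<sigma> ` B j \<subseteq> {1..n}" "card (\<sigma> ` B j) = m" if "\<sigma> \<in> G" "j \<in> {1..k}" for \<sigma> j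
  proof -
    have \<sigma>: "\<sigma> permutes {1..n}"
      using that(1) by (simp add: G_def)
    show "\<sigma> ` B j \<subseteq> {1..n}"
      using B(1)[OF that(2)] permutes_image[OF \<sigma>] by blast
    show "card (\<sigma> ` B j) = m"
      using B(2)[OF that(2)] card_image[OF permutes_inj_on[OF \<sigma>]] by simp
  qed
  have H_indep: "indep_vars (\<lambda>_. borel) (\<lambda>j. H (\<sigma> ` B j)) {1..k}" if "\<sigma> \<in> G" for \<sigma>
  proof -
    have "inj \<sigma>"
      using that permutes_inj by (auto simp: G_def)
    then have "disjoint_family_on (\<lambda>j. \<sigma> ` B j) {1..k}"
      using B_disjoint by (auto simp: disjoint_family_on_def inj_image_mem_iff image_Int[symmetric])
    then have "indep_vars (\<lambda>j. PiM (\<sigma> ` B j) (\<lambda>_. S)) (\<lambda>j \<omega>. restrict (\<lambda>i. Z i \<omega>) (\<sigma> ` B j)) {1..k}"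
      using \<sigma>B that by (intro indep_vars_restrict[OF ind]) auto
    then have "indep_vars (\<lambda>_. borel) (\<lambda>j \<omega>. loo_on A (\<sigma> ` B j) (restrict (\<lambda>i. Z i \<omega>) (\<sigma> ` B j))) {1..k}"
      by (rule indep_vars_compose2) (intro loo_meas \<sigma>B that)
    moreover have "loo_on A (\<sigma> ` B j) (restrict (\<lambda>i. Z i \<omega>) (\<sigma> ` B j)) = H (\<sigma> ` B j) \<omega>" for j \<omega>
      unfolding H_def by (intro loo_on_cong) (auto simp: B_def)
    ultimately show ?thesis
      by simp
  qed
  have W_meas: "W \<sigma> \<in> borel_measurable M" if "\<sigma> \<in> G" for \<sigma>
    unfolding W_def
    by (intro borel_measurable_sum borel_measurable_divide borel_measurable_diff borel_measurable_const H_meas \<sigma>B that)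
  have W_bound: "\<bar>W \<sigma> \<omega>\<bar> \<le> 1" for \<sigma> \<omega>
  proof -
    have "\<bar>W \<sigma> \<omega>\<bar> \<le> (\<Sum>j=1..k. \<bar>(H (\<sigma> ` B j) \<omega> - \<mu>) / k\<bar>)"
      unfolding W_def by (rule sum_abs)
    also have "\<dots> \<le> (\<Sum>j=1..k. 1 / k)"
      using centred[OF H_bounds] by (intro sum_mono) (simp add: divide_right_mono)
    also have "\<dots> = 1"
      using k by simp
    finally show ?thesis .
  qed
  have W_int: "integrable M (\<lambda>\<omega>. \<bar>W \<sigma> \<omega>\<bar> powr q)" if "\<sigma> \<in> G" "q \<ge> 0" for \<sigma> q
  proof (rule integrable_const_bound[where B = 1])
    show "(\<lambda>\<omega>. \<bar>W \<sigma> \<omega>\<bar> powr q) \<in> borel_measurable M"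
      using W_meas[OF that(1)] by measurable
    have "\<bar>W \<sigma> \<omega>\<bar> powr q \<le> 1 powr q" for \<omega>
      using that W_bound by (intro powr_mono2) auto
    then show "AE \<omega> in M. norm (\<bar>W \<sigma> \<omega>\<bar> powr q) \<le> 1"
      by simp
  qed
  have via_W: "expectation (\<lambda>\<omega>. \<bar>Rpn \<omega> - \<mu>\<bar> powr q) \<le> c"
    if "q \<ge> 1" "\<And>\<sigma>. \<sigma> \<in> G \<Longrightarrow> expectation (\<lambda>\<omega>. \<bar>W \<sigma> \<omega>\<bar> powr q) \<le> c" for q c
    unfolding Rpn_W using that
    by (intro expectation_abs_powr_average_le fin_G ne_G W_meas W_int) auto

  \<comment> \<open>The variance bound\<close>
  have part2: "expectation (\<lambda>\<omega>. \<bar>Rpn \<omega> - \<mu>\<bar>\<^sup>2) \<le> expectation (\<lambda>\<omega>. \<bar>R1m \<omega> - \<mu>\<bar>\<^sup>2) / k"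
  proof -
    \<comment> \<open>Real exponents are needed for \<open>via_W\<close>. Each of the k independent
      terms contributes the kernel variance divided by the square of k, which sums to the variance
      over k.\<close>
    have "expectation (\<lambda>\<omega>. \<bar>W \<sigma> \<omega>\<bar> powr 2) \<le> expectation (\<lambda>\<omega>. \<bar>R1m \<omega> - \<mu>\<bar>\<^sup>2) / k" if \<sigma>: "\<sigma> \<in> G" for \<sigma>
    proof -
      define V where "V = (\<lambda>j \<omega>. (H (\<sigma> ` B j) \<omega> - \<mu>) / k)"
      have V_ind: "indep_vars (\<lambda>_. borel) V {1..k}"
        unfolding V_def by (rule indep_vars_compose2[OF H_indep[OF \<sigma>], where Y = "\<lambda>_ x. (x - \<mu>) / k"]) simp
      have V_int: "integrable M (V j)" "expectation (V j) = 0" if "j \<in> {1..k}" for j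
        using H_int[OF \<sigma>B[OF \<sigma> that]] E_H[OF \<sigma>B[OF \<sigma> that]] by (simp_all add: V_def prob_space)
      have V_int2: "integrable M (\<lambda>\<omega>. (V j \<omega>)\<^sup>2)" if "j \<in> {1..k}" for j
        using int_powr[OF H_meas[OF \<sigma>B[OF \<sigma> that]], of 2] H_bounds by (simp add: V_def power_divide)
      have V_sq: "expectation (\<lambda>\<omega>. (V j \<omega>)\<^sup>2) = expectation (\<lambda>\<omega>. \<bar>R1m \<omega> - \<mu>\<bar>\<^sup>2) / (real k)\<^sup>2" if "j \<in> {1..k}" for j
        using E_\<nu>[OF \<sigma>B[OF \<sigma> that], of "\<lambda>x. (x - \<mu>)\<^sup>2"] E_\<nu>[of "{1..m}" "\<lambda>x. (x - \<mu>)\<^sup>2"] m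
        by (simp add: V_def R1m power_divide)
      have "expectation (\<lambda>\<omega>. \<bar>W \<sigma> \<omega>\<bar> powr 2) = expectation (\<lambda>\<omega>. (\<Sum>j=1..k. V j \<omega>)\<^sup>2)"
        by (simp add: W_def V_def powr_numeral)
      also have "\<dots> = (\<Sum>j=1..k. expectation (\<lambda>\<omega>. (V j \<omega>)\<^sup>2))"
        using expectation_square_sum_indep[OF finite_atLeastAtMost V_ind V_int(1) V_int2 V_int(2)] by blast
      also have "\<dots> = (\<Sum>j=1..k. expectation (\<lambda>\<omega>. \<bar>R1m \<omega> - \<mu>\<bar>\<^sup>2) / (real k)\<^sup>2)"
        by (intro sum.cong refl V_sq)
      also have "\<dots> = expectation (\<lambda>\<omega>. \<bar>R1m \<omega> - \<mu>\<bar>\<^sup>2) / k"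
        using k by (simp add: power2_eq_square[of "real k"])
      finally show ?thesis
        by simp
    qed
    then have "expectation (\<lambda>\<omega>. \<bar>Rpn \<omega> - \<mu>\<bar> powr 2) \<le> expectation (\<lambda>\<omega>. \<bar>R1m \<omega> - \<mu>\<bar>\<^sup>2) / k"
      by (intro via_W) auto
    then show ?thesis
      by (simp add: powr_numeral)
  qed

  \<comment> \<open>Moments of order q > 2\<close>
  have part3: "expectation (\<lambda>\<omega>. \<bar>Rpn \<omega> - \<mu>\<bar> powr q) \<le> rosenthal_const q \<gamma> *
      max (2 powr q * \<gamma> * k * expectation (\<lambda>\<omega>. \<bar>(R1m \<omega> - \<mu>) / k\<bar> powr q))
          (sqrt (2 * expectation (\<lambda>\<omega>. (R1m \<omega> - \<mu>)\<^sup>2) / k) powr q)"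
    if q: "q > 2" and \<gamma>: "\<gamma> > 0" for q \<gamma>
  proof (rule via_W)
    fix \<sigma> assume \<sigma>: "\<sigma> \<in> G"
    \<comment> \<open>The blocks enter through their joint law alone, a product of k copies of
      \<nu>; this is the passage from the carrier of \<open>M\<close> to
      \<open>nat \<Rightarrow> real\<close>.\<close>
    have joint: "distr M (PiM {1..k} (\<lambda>_. borel)) (\<lambda>\<omega>. \<lambda>j\<in>{1..k}. H (\<sigma> ` B j) \<omega>) = PiM {1..k} (\<lambda>_. \<nu>)"
      using k \<sigma> by (intro joint_distr_iid H_indep H_distr \<sigma>B) auto
    have "expectation (\<lambda>\<omega>. \<bar>W \<sigma> \<omega>\<bar> powr q)
        = (\<integral>x. \<bar>\<Sum>j=1..k. (x j - \<mu>) / k\<bar> powr q \<partial>PiM {1..k} (\<lambda>_. \<nu>))"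
      unfolding joint[symmetric]
    proof (subst integral_distr)
      show "(\<lambda>\<omega>. \<lambda>j\<in>{1..k}. H (\<sigma> ` B j) \<omega>) \<in> M \<rightarrow>\<^sub>M PiM {1..k} (\<lambda>_. borel)"
        by (intro measurable_restrict H_meas \<sigma>B \<sigma>)
    qed (auto simp: W_def)
    also have "\<dots> \<le> rosenthal_const q \<gamma> * max (2 powr q * \<gamma> * k * (\<integral>x. \<bar>(x - \<mu>) / k\<bar> powr q \<partial>\<nu>))
                               (sqrt (2 * (\<integral>x. (x - \<mu>)\<^sup>2 \<partial>\<nu>) / k) powr q)"
      unfolding \<mu>_def
    proof (rule iid_mean_rosenthal_coordinates[OF \<nu>_prob _ q \<gamma> k])
      show "sets \<nu> = sets borel"
        by (simp add: \<nu>_def)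
      have "integrable M (\<lambda>\<omega>. \<bar>R1m \<omega>\<bar> powr q)"
      proof (rule integrable_const_bound[where B = 1])
        have "\<bar>R1m \<omega>\<bar> powr q \<le> 1 powr q" for \<omega>
          using q H_bounds by (intro powr_mono2) (auto simp: R1m)
        then show "AE \<omega> in M. norm (\<bar>R1m \<omega>\<bar> powr q) \<le> 1"
          by simp
      qed (use R1m_meas in measurable)
      then show "integrable \<nu> (\<lambda>x. \<bar>x\<bar> powr q)"
        unfolding R1m_distr[symmetric] by (simp add: integrable_distr_eq R1m_meas)
    qed
    also have "(\<integral>x. \<bar>(x - \<mu>) / k\<bar> powr q \<partial>\<nu>) = expectation (\<lambda>\<omega>. \<bar>(R1m \<omega> - \<mu>) / k\<bar> powr q)"
      using E_\<nu>[of "{1..m}" "\<lambda>x. \<bar>(x - \<mu>) / k\<bar> powr q"] m by (simp add: R1m)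
    also have "(\<integral>x. (x - \<mu>)\<^sup>2 \<partial>\<nu>) = expectation (\<lambda>\<omega>. (R1m \<omega> - \<mu>)\<^sup>2)"
      using E_\<nu>[of "{1..m}" "\<lambda>x. (x - \<mu>)\<^sup>2"] m by (simp add: R1m)
    finally show "expectation (\<lambda>\<omega>. \<bar>W \<sigma> \<omega>\<bar> powr q) \<le> rosenthal_const q \<gamma> *
      max (2 powr q * \<gamma> * k * expectation (\<lambda>\<omega>. \<bar>(R1m \<omega> - \<mu>) / k\<bar> powr q))
          (sqrt (2 * expectation (\<lambda>\<omega>. (R1m \<omega> - \<mu>)\<^sup>2) / k) powr q)" .
  qed (use q in auto)
  show ?thesis
    unfolding E_Rpn E_R1m floor using part1 part2 part3 by blast
qed

end
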